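(* Let $d\ge1$, $n\ge d$, and let $(\xi_1,\dots,\xi_n)$ be a symmetrically exchangeable tuple of random vectors in $\mathbb{R}^d$, i.e. $(\xi_1,\dots,\xi_n)\stackrel{d}{=}(\varepsilon_1\xi_{\sigma(1)},\dots,\varepsilon_n\xi_{\sigma(n)})$ for every permutation $\sigma$ of $\{1,\dots,n\}$ and every $\varepsilon_1,\dots,\varepsilon_n\in\{-1,1\}$. Let $S_k=\xi_1+\dots+\xi_k$, $1\le k\le n$, and assume that any $d$ random vectors among $S_1,\dots,S_n$ are linearly independent a.s. Then $$\mathbb{P}[0\in\mathrm{Conv}(S_1,\dots,S_n)]=\frac{2}{2^n n!}\big(B(n,d+1)+B(n,d+3)+\dots\big),$$ where $B(n,k)$ are defined by $(t+1)(t+3)\cdots(t+2n-1)=\sum_{k=0}^nB(n,k)t^k$, with $B(n,k)=0$ for $k\notin\{0,\dots,n\}$.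
   Context: $\mathrm{Conv}$ denotes the convex hull. *)

theory Defs
  imports "HOL-Probability.Probability" "HOL-Computational_Algebra.Polynomial"
begin

text \<open>B(n,k): coefficient of t^k in (t+1)(t+3)...(t+2n-1).
  Coefficients of index k > n are automatically 0.\<close>
definition B_coeff :: "nat \<Rightarrow> nat \<Rightarrow> nat" where
  "B_coeff n k = coeff (\<Prod>i\<in>{1..n}. [: 2 * i - 1, 1 :]) k"

definition partial_sum :: "(nat \<Rightarrow> 'b \<Rightarrow> 'a::real_vector) \<Rightarrow> nat \<Rightarrow> 'b \<Rightarrow> 'a" where
  "partial_sum \<xi> k \<omega> = (\<Sum>i\<in>{1..k}. \<xi> i \<omega>)"

end

theory Submission
  imports Defs
begin

text \<open>Summation by parts turns \<open>0 \<in> Conv(S\<^sub>1, \<dots>, S\<^sub>n)\<close>, for the walk with steps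
  \<open>\<epsilon>\<^sub>i \<xi>(\<sigma>(i))\<close>, into the statement that the Weyl chamber of type \<open>B\<^sub>n\<close> belonging to
  \<open>(\<sigma>, \<epsilon>)\<close> meets the space \<open>L\<close> of linear relations \<open>\<Sum> y\<^sub>i \<xi>\<^sub>i = 0\<close>. By exchangeability the
  probability is the expected number of chambers met by \<open>L\<close>, divided by \<open>2\<^sup>n n!\<close>. This number is
  almost surely constant: if \<open>r(n, e)\<close> counts the chambers met by a generic subspace of codimension
  \<open>e\<close>, then adding the \<open>2n + 1\<close> hyperplanes that involve a new coordinate one at a time to the
  arrangement \<open>B\<^sub>n\<close> creates \<open>r(n, e)\<close> new regions each, since every one of them carries a copy of
  \<open>B\<^sub>n\<close>. Hence \<open>r(n + 1, e) = r(n, e - 1) + (2n + 1) r(n, e)\<close>, the recursion satisfied by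
  \<open>2 (B(n, e + 1) + B(n, e + 3) + \<dots>)\<close>.\<close>

section \<open>Deletion and restriction\<close>

text \<open>The obstacle is that general position must survive the induction on \<open>n\<close>. On
  the new hyperplane \<open>y a = 0\<close> the relations are those without \<open>x a\<close>; on
  \<open>y a = t * y j\<close> they are those with \<open>x j\<close> replaced by
  \<open>x j + t x a\<close>. The term \<open>r(n, e - 1)\<close> has another origin: before any new
  hyperplane is added, the old forms do not see the coordinate \<open>a\<close>, and forgetting it
  turns relations modulo \<open>U\<close> into relations modulo the span of \<open>U\<close> and
  \<open>x a\<close>. The condition \<open>generic\<close> is stable under all three operations
  because a signed chain of index sets on the smaller index set lifts to one on the larger.

  The number \<open>2n + 1\<close> counts one coordinate hyperplane and two signs for each of the
  \<open>n\<close> older indices. The factor 2 comes from the start of the recursion: a single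
  coordinate in codimension 0 has two regions. For \<open>e = 0\<close> the recursion would call for
  \<open>r(n, -1)\<close>, while forgetting a coordinate of the whole space yields
  \<open>r(n, 0)\<close>; the formula agrees with this because the even and the odd coefficients
  have equal sums.\<close>

definition linear_form :: "(('i \<Rightarrow> real) \<Rightarrow> real) \<Rightarrow> bool" where
  "linear_form f \<longleftrightarrow> (\<forall>y z c. f (\<lambda>i. y i + c * z i) = f y + c * f z)"

definition linear_set :: "('i \<Rightarrow> real) set \<Rightarrow> bool" where
  "linear_set V \<longleftrightarrow> (\<forall>y\<in>V. \<forall>z\<in>V. \<forall>c. (\<lambda>i. y i + c * z i) \<in> V)"

text \<open>A region is represented by the set of forms that are positive on it.\<close>

definition regions :: "('i \<Rightarrow> real) set \<Rightarrow> (('i \<Rightarrow> real) \<Rightarrow> real) set \<Rightarrow> (('i \<Rightarrow> real) \<Rightarrow> real) set set" where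
  "regions V F = (\<lambda>y. {f \<in> F. f y > 0}) ` {y \<in> V. \<forall>f\<in>F. f y \<noteq> 0}"

text \<open>Along the ray from \<open>y\<close> in direction \<open>v\<close> each form is affine in
  \<open>c\<close>, so its nonzero sign at \<open>y\<close> persists for small \<open>c > 0\<close>;
  finiteness of \<open>F\<close> gives a common \<open>c\<close>.\<close>

lemma small_perturbation:
  assumes "finite F" "\<And>f. f \<in> F \<Longrightarrow> linear_form f" "\<And>f. f \<in> F \<Longrightarrow> f y \<noteq> 0"
  obtains c where "c > 0"
    "\<And>f. f \<in> F \<Longrightarrow> sgn (f (\<lambda>i. y i + c * v i)) = sgn (f y)"
proof -
  have "eventually (\<lambda>c. sgn (f y + c * f v) = sgn (f y)) (at_right 0)" if "f \<in> F" for f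
  proof -
    have lim: "((\<lambda>c. f y + c * f v) \<longlongrightarrow> f y + 0 * f v) (at_right 0)"
      by (intro tendsto_intros)
    show ?thesis
    proof (cases "f y > 0")
      case True
      then have "eventually (\<lambda>c. f y + c * f v > 0) (at_right 0)"
        using order_tendstoD(1)[OF lim, of 0] by simp
      then show ?thesis by eventually_elim (use True in simp)
    next
      case False
      with assms(3)[OF that] have neg: "f y < 0" by simp
      then have "eventually (\<lambda>c. f y + c * f v < 0) (at_right 0)"
        using order_tendstoD(2)[OF lim, of 0] by simp
      then show ?thesis by eventually_elim (use neg in simp)
    qed
  qed
  then have "eventually (\<lambda>c. \<forall>f\<in>F. sgn (f y + c * f v) = sgn (f y)) (at_right 0)"
    using assms(1) by (simp add: eventually_ball_finite)
  then have "eventually (\<lambda>c. (\<forall>f\<in>F. sgn (f y + c * f v) = sgn (f y)) \<and> c > 0) (at_right 0)"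
    using eventually_at_right_less eventually_conj by blast
  then obtain c where "c > 0" "\<forall>f\<in>F. sgn (f y + c * f v) = sgn (f y)"
    using eventually_happens[of _ "at_right (0::real)"] by force
  then show ?thesis using that assms(2) by (auto simp: linear_form_def)
qed

text \<open>A region of \<open>F\<close> is cut in two by \<open>h\<close> exactly when it meets
  \<open>h = 0\<close>. With \<open>P\<close> and \<open>Q\<close> the families of regions reaching
  the two sides, the count is \<open>|P| + |Q| = |P \<union> Q| + |P \<inter> Q|\<close>: the union
  is all regions of \<open>F\<close>, the intersection those met by the hyperplane. The vector
  \<open>v\<close> pushes points of \<open>h = 0\<close> to either side.\<close>

lemma deletion_restriction:
  assumes fin: "finite F" and lin: "\<And>f. f \<in> F \<Longrightarrow> linear_form f" and h: "linear_form h"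
    and V: "linear_set V"
    and v: "v \<in> V" "h v \<noteq> 0"
  shows "card (regions V (insert h F)) = card (regions V F) + card (regions {y \<in> V. h y = 0} F)"
proof (cases "h \<in> F")
  \<comment> \<open>Here \<open>h\<close> itself is one of the forms, so no point of
    \<open>h = 0\<close> is regular and the second summand is 0.\<close>
  case True
  then have "regions {y \<in> V. h y = 0} F = {}" by (auto simp: regions_def)
  with True show ?thesis by (simp add: insert_absorb)
next
  case False
  define R where "R Q = (\<lambda>y. {f \<in> F. f y > 0}) ` {y \<in> V. (\<forall>f\<in>F. f y \<noteq> 0) \<and> Q (h y)}"
    for Q :: "real \<Rightarrow> bool"
  have finR: "finite (R Q)" for Q
    by (rule finite_subset[of _ "Pow F"]) (use fin in \<open>auto simp: R_def\<close>)
  have notin: "h \<notin> P" if "P \<in> R Q" for P Q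
    using that False by (auto simp: R_def)
  \<comment> \<open>Patterns on the positive side gain the element \<open>h\<close>, the others stay
    as they are. As \<open>h\<close> is not in \<open>F\<close>, the two families are disjoint and
    \<open>insert h\<close> is injective.\<close>
  have split: "regions V (insert h F) = insert h ` R (\<lambda>t. t > 0) \<union> R (\<lambda>t. t < 0)"
  proof (intro equalityI subsetI)
    fix P assume "P \<in> regions V (insert h F)"
    then obtain y where y: "y \<in> V" "\<forall>f\<in>insert h F. f y \<noteq> 0" "P = {f \<in> insert h F. f y > 0}"
      by (auto simp: regions_def)
    show "P \<in> insert h ` R (\<lambda>t. t > 0) \<union> R (\<lambda>t. t < 0)"
    proof (cases "h y > 0")
      case True
      then have "P = insert h {f \<in> F. f y > 0}" using y by auto
      then show ?thesis using y True by (auto simp: R_def)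
    next
      case F: False
      then have "P = {f \<in> F. f y > 0}" using y by auto
      moreover have "h y < 0" using F y by auto
      ultimately show ?thesis using y by (auto simp: R_def)
    qed
  next
    fix P assume "P \<in> insert h ` R (\<lambda>t. t > 0) \<union> R (\<lambda>t. t < 0)"
    then consider y where "y \<in> V" "\<forall>f\<in>F. f y \<noteq> 0" "h y > 0" "P = insert h {f \<in> F. f y > 0}"
      | y where "y \<in> V" "\<forall>f\<in>F. f y \<noteq> 0" "h y < 0" "P = {f \<in> F. f y > 0}"
      by (auto simp: R_def)
    then show "P \<in> regions V (insert h F)"
    proof cases
      case 1
      then have "P = {f \<in> insert h F. f y > 0}" by auto
      with 1 show ?thesis unfolding regions_def by (intro image_eqI[of _ _ y]) auto
    next
      case 2
      then have "P = {f \<in> insert h F. f y > 0}" by auto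
      with 2 show ?thesis unfolding regions_def by (intro image_eqI[of _ _ y]) auto
    qed
  qed
  have "card (regions V (insert h F)) = card (insert h ` R (\<lambda>t. t > 0)) + card (R (\<lambda>t. t < 0))"
    unfolding split by (rule card_Un_disjoint) (use finR notin in auto)
  also have "card (insert h ` R (\<lambda>t. t > 0)) = card (R (\<lambda>t. t > 0))"
    by (rule card_image) (meson inj_onI insert_ident notin)
  also have "card (R (\<lambda>t. t > 0)) + card (R (\<lambda>t. t < 0))
      = card (R (\<lambda>t. t > 0) \<union> R (\<lambda>t. t < 0)) + card (R (\<lambda>t. t > 0) \<inter> R (\<lambda>t. t < 0))"
    by (rule card_Un_Int) (use finR in auto)
  finally have card_eq: "card (regions V (insert h F))
      = card (R (\<lambda>t. t > 0) \<union> R (\<lambda>t. t < 0)) + card (R (\<lambda>t. t > 0) \<inter> R (\<lambda>t. t < 0))" .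
  have perturb: "\<exists>z\<in>V. (\<forall>f\<in>F. f z \<noteq> 0) \<and> {f \<in> F. f z > 0} = {f \<in> F. f y > 0} \<and> h z * s > 0"
    if yV: "y \<in> V" and y0: "\<forall>f\<in>F. f y \<noteq> 0" and hy: "h y = 0" and s: "s \<noteq> 0" for y s
  proof -
    \<comment> \<open>This is the multiple \<open>(s * h v) v\<close>, so that \<open>h w\<close>
      has the sign of \<open>s\<close>; it is written as \<open>v\<close> plus a multiple of
      \<open>v\<close> because this is the only combination that \<open>linear_set\<close>
      offers.\<close>
    define w where "w = (\<lambda>i. v i + (s * h v - 1) * v i)"
    have w: "w \<in> V" unfolding w_def using V v by (auto simp: linear_set_def)
    have "h w = h v + (s * h v - 1) * h v" using h unfolding w_def linear_form_def by blast
    then have hw: "h w = s * (h v)\<^sup>2" by (simp add: algebra_simps power2_eq_square)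
    obtain c where c: "c > 0" "\<And>f. f \<in> F \<Longrightarrow> sgn (f (\<lambda>i. y i + c * w i)) = sgn (f y)"
      using small_perturbation[of F y w] fin lin y0 by metis
    let ?z = "\<lambda>i. y i + c * w i"
    have "?z \<in> V" using V yV w by (auto simp: linear_set_def)
    moreover have "\<forall>f\<in>F. f ?z \<noteq> 0" using c(2) y0 by (metis sgn_0_0)
    moreover have "f ?z > 0 \<longleftrightarrow> f y > 0" if "f \<in> F" for f
      using c(2)[OF that] by (metis sgn_greater)
    then have "{f \<in> F. f ?z > 0} = {f \<in> F. f y > 0}" by auto
    moreover have "h ?z * s = c * (s\<^sup>2 * (h v)\<^sup>2)"
      using h hy hw by (simp add: linear_form_def power2_eq_square algebra_simps)
    then have "h ?z * s > 0" using c(1) s v(2) by simp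
    ultimately show ?thesis by blast
  qed
  have "R (\<lambda>t. t > 0) \<union> R (\<lambda>t. t < 0) = regions V F"
  proof (intro equalityI subsetI)
    fix P assume "P \<in> regions V F"
    then obtain y where y: "y \<in> V" "\<forall>f\<in>F. f y \<noteq> 0" "P = {f \<in> F. f y > 0}"
      by (auto simp: regions_def)
    show "P \<in> R (\<lambda>t. t > 0) \<union> R (\<lambda>t. t < 0)"
    proof (cases "h y = 0")
      case True
      then obtain z where "z\<in>V" "\<forall>f\<in>F. f z \<noteq> 0" "{f \<in> F. f z > 0} = P" "h z > 0"
        using perturb[of y 1] y by auto
      then show ?thesis by (auto simp: R_def)
    qed (use y in \<open>auto simp: R_def linorder_neq_iff\<close>)
  qed (auto simp: R_def regions_def)
  moreover have "R (\<lambda>t. t > 0) \<inter> R (\<lambda>t. t < 0) = regions {y \<in> V. h y = 0} F"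
  proof (intro equalityI subsetI)
    fix P assume "P \<in> R (\<lambda>t. t > 0) \<inter> R (\<lambda>t. t < 0)"
    then obtain y z where y: "y \<in> V" "\<forall>f\<in>F. f y \<noteq> 0" "h y > 0" "P = {f \<in> F. f y > 0}"
      and z: "z \<in> V" "\<forall>f\<in>F. f z \<noteq> 0" "h z < 0" "P = {f \<in> F. f z > 0}"
      by (auto simp: R_def)
    \<comment> \<open>Up to scaling, \<open>y + c z\<close> is the point where the segment from
      \<open>y\<close> to \<open>z\<close> crosses \<open>h = 0\<close>. Since \<open>c > 0\<close>,
      every form with equal signs at \<open>y\<close> and \<open>z\<close> keeps that sign.\<close>
    define c where "c = - h y / h z"
    have c: "c > 0" using y z by (simp add: c_def divide_pos_neg)
    let ?w = "\<lambda>i. y i + c * z i"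
    have w: "?w \<in> V" using V y z by (auto simp: linear_set_def)
    have "h ?w = h y + c * h z" using h by (simp add: linear_form_def)
    then have hw: "h ?w = 0" using z by (simp add: c_def)
    have sg: "f ?w \<noteq> 0 \<and> (f ?w > 0 \<longleftrightarrow> f y > 0)" if f: "f \<in> F" for f
    proof -
      have e: "f ?w = f y + c * f z" using lin[OF f] by (simp add: linear_form_def)
      show ?thesis
      proof (cases "f y > 0")
        case True
        then have "f z > 0" using y z f by blast
        then have "f ?w > 0" using True c e by (simp add: add_pos_pos)
        then show ?thesis using True by simp
      next
        case F: False
        then have "\<not> f z > 0" using y z f by blast
        then have "f z < 0" "f y < 0" using F y z f by (auto simp: linorder_neq_iff)
        then have "f ?w < 0" using c e by (simp add: add_neg_neg mult_pos_neg)
        then show ?thesis using F by auto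
      qed
    qed
    then have "P = {f \<in> F. f ?w > 0}" using y by auto
    then show "P \<in> regions {y \<in> V. h y = 0} F"
      unfolding regions_def using w hw sg by (intro image_eqI[of _ _ ?w]) auto
  next
    fix P assume "P \<in> regions {y \<in> V. h y = 0} F"
    then obtain y where y: "y \<in> V" "\<forall>f\<in>F. f y \<noteq> 0" "h y = 0" "P = {f \<in> F. f y > 0}"
      by (auto simp: regions_def)
    obtain z where "z\<in>V" "\<forall>f\<in>F. f z \<noteq> 0" "{f \<in> F. f z > 0} = P" "h z > 0"
      using perturb[of y 1] y by auto
    moreover obtain z' where "z'\<in>V" "\<forall>f\<in>F. f z' \<noteq> 0" "{f \<in> F. f z' > 0} = P" "h z' < 0"
      using perturb[of y "-1"] y by auto
    ultimately show "P \<in> R (\<lambda>t. t > 0) \<inter> R (\<lambda>t. t < 0)" by (auto simp: R_def)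
  qed
  ultimately show ?thesis using card_eq by simp
qed

text \<open>Where \<open>f\<close> vanishes on \<open>V\<close>, so does a form of \<open>G\<close>;
  hence the restriction to \<open>f = 0\<close> has no regions and adding \<open>f\<close> creates
  none.\<close>

lemma card_regions_proportional:
  assumes "finite K" and "finite G"
    and "\<And>f. f \<in> G \<union> K \<Longrightarrow> linear_form f"
    and V: "linear_set V"
    and proportional: "\<And>f. f \<in> K \<Longrightarrow> \<exists>g\<in>G. \<exists>c. c \<noteq> 0 \<and> (\<forall>y\<in>V. f y = c * g y)"
  shows "card (regions V (G \<union> K)) = card (regions V G)"
  using assms(1,3) proportional
proof (induction K)
  case (insert f K)
  obtain g c where g: "g \<in> G" "c \<noteq> 0" "\<And>y. y \<in> V \<Longrightarrow> f y = c * g y"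
    using insert.prems(2)[of f] by blast
  have IH: "card (regions V (G \<union> K)) = card (regions V G)"
    using insert by simp
  show ?case
  proof (cases "\<exists>v\<in>V. f v \<noteq> 0")
    case True
    then obtain v where v: "v \<in> V" "f v \<noteq> 0" by blast
    have "regions {y \<in> V. f y = 0} (G \<union> K) = {}"
      using g by (auto simp: regions_def)
    moreover have "card (regions V (insert f (G \<union> K)))
        = card (regions V (G \<union> K)) + card (regions {y \<in> V. f y = 0} (G \<union> K))"
      by (rule deletion_restriction[where v = v]) (use insert assms(2) V v in auto)
    ultimately show ?thesis using IH by simp
  next
    \<comment> \<open>Without a point off \<open>f = 0\<close>, deletion and restriction does not
      apply; but then \<open>g\<close> also vanishes on \<open>V\<close> and both counts are
      0.\<close>
    case False
    then have "\<And>y. y \<in> V \<Longrightarrow> g y = 0" using g by auto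
    then have "regions V (G \<union> insert f K) = {}" "regions V G = {}"
      using g(1) by (auto simp: regions_def)
    then show ?thesis by simp
  qed
qed simp

section \<open>Vectors in general position\<close>

lemma dim_Un_finite_le:
  fixes U W :: "'a::euclidean_space set"
  assumes "finite W"
  shows "dim (U \<union> W) \<le> dim U + card W"
  using assms
proof (induction W)
  case (insert w W)
  have "dim (insert w (U \<union> W)) \<le> dim (U \<union> W) + 1" by (simp add: dim_insert)
  with insert show ?case by simp
qed simp

text \<open>Dimension count: if some \<open>c k\<close> were nonzero, \<open>v k\<close> could be
  dropped from the spanning family, leaving fewer vectors than the codimension of
  \<open>U\<close>.\<close>

lemma independent_modulo:
  fixes v :: "'k \<Rightarrow> 'a::euclidean_space"
  assumes K: "finite K" and U: "subspace U" and "dim U + card K \<le> DIM('a)"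
    and sp: "span (U \<union> v ` K) = UNIV"
    and sum: "(\<Sum>k\<in>K. c k *\<^sub>R v k) \<in> U"
  shows "\<forall>k\<in>K. c k = 0"
proof (rule ccontr)
  assume "\<not> ?thesis"
  then obtain k where k: "k \<in> K" "c k \<noteq> 0" by blast
  let ?W = "U \<union> v ` (K - {k})"
  have "(\<Sum>i\<in>K. c i *\<^sub>R v i) = c k *\<^sub>R v k + (\<Sum>i\<in>K-{k}. c i *\<^sub>R v i)"
    using k K by (simp add: sum.remove)
  then have "c k *\<^sub>R v k = (\<Sum>i\<in>K. c i *\<^sub>R v i) - (\<Sum>i\<in>K-{k}. c i *\<^sub>R v i)" by simp
  also have "\<dots> \<in> span ?W"
  proof (rule span_diff)
    show "(\<Sum>i\<in>K. c i *\<^sub>R v i) \<in> span ?W" using sum by (simp add: span_base)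
    show "(\<Sum>i\<in>K-{k}. c i *\<^sub>R v i) \<in> span ?W"
      by (intro span_sum span_scale span_base) auto
  qed
  finally have "v k \<in> span ?W"
    using k(2) by (metis span_scale scaleR_scaleR left_inverse scaleR_one)
  moreover have "U \<union> v ` K = insert (v k) ?W" using k by auto
  ultimately have "span ?W = UNIV" using sp by (simp add: span_redundant)
  then have "DIM('a) = dim ?W" by (metis dim_UNIV dim_span)
  also have "\<dots> \<le> dim U + card (v ` (K - {k}))" by (rule dim_Un_finite_le) (use K in simp)
  also have "\<dots> \<le> dim U + card (K - {k})" using K by (simp add: card_image_le)
  also have "\<dots> < dim U + card K" using card_Diff1_less[OF K k(1)] by simp
  finally show False using assms(3) by simp
qed

text \<open>\<open>e\<close> is the codimension of \<open>U\<close>; a chain of \<open>e\<close> index sets plays the role of \<open>e\<close> partial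
  sums along one signed permutation. Working modulo \<open>U\<close> replaces projections to quotient spaces.\<close>

definition generic :: "'a::euclidean_space set \<Rightarrow> ('i \<Rightarrow> 'a) \<Rightarrow> 'i set \<Rightarrow> nat \<Rightarrow> bool" where
  "generic U x A e \<longleftrightarrow> subspace U \<and> dim U + e \<le> DIM('a) \<and>
     (\<forall>s \<B>. (\<forall>i\<in>A. s i \<in> {-1, 1::real}) \<longrightarrow> \<B> \<subseteq> Pow A - {{}} \<longrightarrow>
        (\<forall>B\<in>\<B>. \<forall>C\<in>\<B>. B \<subseteq> C \<or> C \<subseteq> B) \<longrightarrow> card \<B> = e \<longrightarrow>
        span (U \<union> (\<lambda>B. \<Sum>i\<in>B. s i *\<^sub>R x i) ` \<B>) = UNIV)"

lemma generic_spanD: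
  assumes "generic U x A e" "\<forall>i\<in>A. s i \<in> {-1, 1}" "\<B> \<subseteq> Pow A - {{}}"
    "\<forall>B\<in>\<B>. \<forall>C\<in>\<B>. B \<subseteq> C \<or> C \<subseteq> B" "card \<B> = e"
  shows "span (U \<union> (\<lambda>B. \<Sum>i\<in>B. s i *\<^sub>R x i) ` \<B>) = UNIV"
  using assms unfolding generic_def by blast

lemma generic_subspace: "generic U x A e \<Longrightarrow> subspace U"
  by (simp add: generic_def)

text \<open>For \<open>U = {0}\<close> this is the space \<open>L\<close>; in general these are the
  linear relations in the quotient by \<open>U\<close>. Coordinates outside \<open>A\<close> are
  free, which is harmless because the forms used with it read only coordinates in
  \<open>A\<close>.\<close>

definition relations :: "'a::euclidean_space set \<Rightarrow> ('i \<Rightarrow> 'a) \<Rightarrow> 'i set \<Rightarrow> ('i \<Rightarrow> real) set" where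
  "relations U x A = {y. (\<Sum>i\<in>A. y i *\<^sub>R x i) \<in> U}"

lemma linear_set_relations:
  assumes "subspace U"
  shows "linear_set (relations U x A)"
proof -
  have "(\<Sum>i\<in>A. (y i + c * z i) *\<^sub>R x i) = (\<Sum>i\<in>A. y i *\<^sub>R x i) + c *\<^sub>R (\<Sum>i\<in>A. z i *\<^sub>R x i)"
    for y z c by (simp add: scaleR_add_left sum.distrib scaleR_sum_right)
  then show ?thesis using assms by (simp add: linear_set_def relations_def subspace_add subspace_scale)
qed

lemma exists_chain:
  assumes "finite A" "e \<le> card A"
  shows "\<exists>\<B>. \<B> \<subseteq> Pow A - {{}} \<and> (\<forall>B\<in>\<B>. \<forall>C\<in>\<B>. B \<subseteq> C \<or> C \<subseteq> B) \<and> card \<B> = e"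
  using assms
proof (induction A arbitrary: e)
  case empty
  then show ?case by (intro exI[of _ "{}"]) auto
next
  case (insert a A)
  show ?case
  proof (cases e)
    case 0
    then show ?thesis by (intro exI[of _ "{}"]) auto
  next
    case (Suc e')
    then have "e' \<le> card A" using insert by simp
    from insert.IH[OF this]
    obtain \<B> where B: "\<B> \<subseteq> Pow A - {{}}" "\<forall>B\<in>\<B>. \<forall>C\<in>\<B>. B \<subseteq> C \<or> C \<subseteq> B" "card \<B> = e'"
      by blast
    have "finite \<B>" using B(1) insert(1) finite_subset[of \<B> "Pow A"] by blast
    moreover have "insert a A \<notin> \<B>" using B(1) insert(2) by auto
    ultimately have "card (insert (insert a A) \<B>) = e" using B Suc by simp
    then show ?thesis using B(1,2) by (intro exI[of _ "insert (insert a A) \<B>"]) auto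
  qed
qed

text \<open>As \<open>e\<close> does not exceed \<open>card A\<close>, a chain of length
  \<open>e\<close> exists; its sums with all signs 1 span modulo \<open>U\<close> and are
  combinations of the vectors \<open>x i\<close>.\<close>

lemma generic_span:
  assumes "generic U x A e" "finite A" "e \<le> card A"
  shows "span (U \<union> x ` A) = UNIV"
proof -
  obtain \<B> where B: "\<B> \<subseteq> Pow A - {{}}" "\<forall>B\<in>\<B>. \<forall>C\<in>\<B>. B \<subseteq> C \<or> C \<subseteq> B" "card \<B> = e"
    using exists_chain[OF assms(2,3)] by blast
  have "span (U \<union> (\<lambda>B. \<Sum>i\<in>B. (1::real) *\<^sub>R x i) ` \<B>) = UNIV"
    by (rule generic_spanD[OF assms(1) _ B]) simp
  moreover have "U \<union> (\<lambda>B. \<Sum>i\<in>B. (1::real) *\<^sub>R x i) ` \<B> \<subseteq> span (U \<union> x ` A)"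
    using B(1) by (auto intro!: span_sum intro: span_base)
  ultimately show ?thesis by (metis span_minimal subspace_span top.extremum_uniqueI)
qed

lemma generic_remove:
  assumes "generic U x A e"
  shows "generic U x (A - {a}) e"
  unfolding generic_def
proof (intro conjI allI impI)
  fix s :: "'b \<Rightarrow> real" and \<B>
  assume s: "\<forall>i\<in>A-{a}. s i \<in> {-1, 1::real}" and B: "\<B> \<subseteq> Pow (A-{a}) - {{}}"
    "\<forall>B\<in>\<B>. \<forall>C\<in>\<B>. B \<subseteq> C \<or> C \<subseteq> B" "card \<B> = e"
  define s' where "s' = s(a := 1)"
  have "(\<lambda>B. \<Sum>i\<in>B. s i *\<^sub>R x i) ` \<B> = (\<lambda>B. \<Sum>i\<in>B. s' i *\<^sub>R x i) ` \<B>"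
    using B(1) by (intro image_cong refl sum.cong) (auto simp: s'_def)
  moreover have "\<forall>i\<in>A. s' i \<in> {-1, 1::real}" using s by (auto simp: s'_def)
  moreover have "\<B> \<subseteq> Pow A - {{}}" using B by blast
  ultimately show "span (U \<union> (\<lambda>B. \<Sum>i\<in>B. s i *\<^sub>R x i) ` \<B>) = UNIV"
    using generic_spanD[OF assms _ _ B(2,3)] by simp
qed (use assms in \<open>auto simp: generic_def\<close>)

text \<open>A chain on \<open>A - {a}\<close> lifts to \<open>A\<close> by adding \<open>a\<close>
  to each member containing \<open>j\<close>, with the sign \<open>s j * t\<close> at
  \<open>a\<close>. The lift preserves inclusions, is injective and reproduces the sums of the
  merged vectors.\<close>

lemma generic_merge:
  assumes gen: "generic U x A e" and fin: "finite A" and a: "a \<in> A" "j \<in> A" "j \<noteq> a" and t: "t \<in> {-1, 1}"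
  shows "generic U (x(j := x j + t *\<^sub>R x a)) (A - {a}) e"
  unfolding generic_def
proof (intro conjI allI impI)
  fix s :: "'b \<Rightarrow> real" and \<B>
  assume s: "\<forall>i\<in>A-{a}. s i \<in> {-1, 1::real}" and B: "\<B> \<subseteq> Pow (A-{a}) - {{}}"
    "\<forall>B\<in>\<B>. \<forall>C\<in>\<B>. B \<subseteq> C \<or> C \<subseteq> B" "card \<B> = e"
  define s' where "s' = s(a := s j * t)"
  define up where "up B = (if j \<in> B then insert a B else B)" for B
  have notin: "a \<notin> B" if "B \<in> \<B>" for B using B that by auto
  have inj: "inj_on up \<B>"
  proof (rule inj_onI)
    fix B C assume BC: "B \<in> \<B>" "C \<in> \<B>" "up B = up C"
    have "B = up B - {a}" if "B \<in> \<B>" for B using notin[OF that] by (simp add: up_def)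
    then show "B = C" using BC by metis
  qed
  have eq: "(\<Sum>i\<in>B. s i *\<^sub>R (x(j := x j + t *\<^sub>R x a)) i) = (\<Sum>i\<in>up B. s' i *\<^sub>R x i)"
    if "B \<in> \<B>" for B
  proof -
    have B': "finite B" "a \<notin> B" using that B fin by (auto intro: finite_subset[of B A])
    have same: "(\<Sum>i\<in>B - {j}. s i *\<^sub>R (x(j := x j + t *\<^sub>R x a)) i) = (\<Sum>i\<in>B - {j}. s' i *\<^sub>R x i)"
      using B' by (intro sum.cong) (auto simp: s'_def)
    show ?thesis
    proof (cases "j \<in> B")
      case True
      have "(\<Sum>i\<in>B. s i *\<^sub>R (x(j := x j + t *\<^sub>R x a)) i)
          = s j *\<^sub>R (x j + t *\<^sub>R x a) + (\<Sum>i\<in>B - {j}. s' i *\<^sub>R x i)"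
        unfolding same[symmetric] using B' True by (subst sum.remove[of B j]) auto
      also have "s j *\<^sub>R (x j + t *\<^sub>R x a) = s' a *\<^sub>R x a + s' j *\<^sub>R x j"
        using a(3) by (simp add: s'_def scaleR_add_right)
      also have "\<dots> + (\<Sum>i\<in>B - {j}. s' i *\<^sub>R x i) = s' a *\<^sub>R x a + (\<Sum>i\<in>B. s' i *\<^sub>R x i)"
        using B' True by (subst sum.remove[of B j]) auto
      finally show ?thesis using B' True by (simp add: up_def)
    next
      case False
      then show ?thesis using same by (simp add: up_def)
    qed
  qed
  have im: "(\<lambda>B. \<Sum>i\<in>B. s i *\<^sub>R (x(j := x j + t *\<^sub>R x a)) i) ` \<B>
      = (\<lambda>B. \<Sum>i\<in>B. s' i *\<^sub>R x i) ` (up ` \<B>)"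
    unfolding image_image using eq by (intro image_cong) auto
  have "\<forall>i\<in>A. s' i \<in> {-1, 1::real}" using s t a by (auto simp: s'_def)
  moreover have "up ` \<B> \<subseteq> Pow A - {{}}" using B(1) a by (auto simp: up_def split: if_splits)
  moreover have "\<forall>B\<in>up ` \<B>. \<forall>C\<in>up ` \<B>. B \<subseteq> C \<or> C \<subseteq> B"
  proof -
    have "up B \<subseteq> up C \<or> up C \<subseteq> up B" if "B \<in> \<B>" "C \<in> \<B>" for B C
    proof -
      have "B \<subseteq> C \<or> C \<subseteq> B" using B(2) that by simp
      then show ?thesis by (auto simp: up_def)
    qed
    then show ?thesis by blast
  qed
  moreover have "card (up ` \<B>) = e" using B(3) inj by (simp add: card_image)
  ultimately show "span (U \<union> (\<lambda>B. \<Sum>i\<in>B. s i *\<^sub>R (x(j := x j + t *\<^sub>R x a)) i) ` \<B>) = UNIV"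
    unfolding im by (intro generic_spanD[OF gen])
qed (use gen in \<open>auto simp: generic_def\<close>)

text \<open>Passing to the quotient by \<open>x a\<close> costs one codimension, and the lifted
  chain is longer by one: \<open>a\<close> joins every member, and \<open>{a}\<close> is put at the
  bottom.\<close>

lemma generic_project:
  assumes gen: "generic U x A e" and fin: "finite A" and a: "a \<in> A"
  shows "generic (span (insert (x a) U)) x (A - {a}) (e - 1)"
  unfolding generic_def
proof (intro conjI allI impI)
  have U: "span U = U" using gen by (simp add: generic_def span_eq_iff)
  show "dim (span (insert (x a) U)) + (e - 1) \<le> DIM('a)"
  proof (cases e)
    case 0
    then show ?thesis using dim_subset_UNIV by auto
  next
    case (Suc e')
    then show ?thesis using gen by (simp add: generic_def dim_insert)
  qed
  fix s :: "'b \<Rightarrow> real" and \<B>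
  assume s: "\<forall>i\<in>A-{a}. s i \<in> {-1, 1::real}" and B: "\<B> \<subseteq> Pow (A-{a}) - {{}}"
    "\<forall>B\<in>\<B>. \<forall>C\<in>\<B>. B \<subseteq> C \<or> C \<subseteq> B" "card \<B> = e - 1"
  let ?W = "span (insert (x a) U) \<union> (\<lambda>B. \<Sum>i\<in>B. s i *\<^sub>R x i) ` \<B>"
  show "span ?W = UNIV"
  proof (cases e)
    \<comment> \<open>Truncated subtraction keeps the codimension at 0. The empty chain already
      forces \<open>U\<close> to be the whole space.\<close>
    case 0
    have "span U = UNIV"
      using generic_spanD[OF gen, of "\<lambda>_. 1" "{}"] 0 by simp
    then have "span (insert (x a) U) = UNIV" by (metis span_mono subset_insertI top.extremum_uniqueI)
    then show ?thesis by simp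
  next
    case (Suc e')
    define s' where "s' = s(a := 1)"
    have notin: "a \<notin> B" "B \<noteq> {}" "finite B" if "B \<in> \<B>" for B 
      using B that fin by (auto intro: finite_subset[of B A])
    have fB: "finite \<B>" using B(1) fin finite_subset[of \<B> "Pow A"] by blast
    \<comment> \<open>Members of the old chain are nonempty and avoid \<open>a\<close>, so
      \<open>{a}\<close> is a new set. Modulo \<open>x a\<close> the sums over
      \<open>insert a B\<close> and over \<open>B\<close> agree.\<close>
    let ?C = "insert {a} (insert a ` \<B>)"
    have "inj_on (insert a) \<B>" by (meson inj_onI insert_ident notin(1))
    moreover have "{a} \<notin> insert a ` \<B>"
    proof
      assume "{a} \<in> insert a ` \<B>"
      then obtain B where "B \<in> \<B>" "insert a B = {a}" by auto
      then show False using notin by blast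
    qed
    ultimately have "card ?C = e" using B(3) Suc fB by (simp add: card_image)
    moreover have "\<forall>i\<in>A. s' i \<in> {-1, 1::real}" using s by (auto simp: s'_def)
    moreover have "?C \<subseteq> Pow A - {{}}" using B(1) a by auto
    moreover have "\<forall>B\<in>?C. \<forall>C\<in>?C. B \<subseteq> C \<or> C \<subseteq> B" using B(2) by auto
    ultimately have "span (U \<union> (\<lambda>B. \<Sum>i\<in>B. s' i *\<^sub>R x i) ` ?C) = UNIV"
      by (intro generic_spanD[OF gen])
    moreover have "U \<union> (\<lambda>B. \<Sum>i\<in>B. s' i *\<^sub>R x i) ` ?C \<subseteq> span ?W"
    proof -
      have xa: "x a \<in> span ?W" by (intro span_base) (simp add: span_base)
      have "(\<Sum>i\<in>insert a B. s' i *\<^sub>R x i) \<in> span ?W" if "B \<in> \<B>" for B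
      proof -
        have "(\<Sum>i\<in>insert a B. s' i *\<^sub>R x i) = x a + (\<Sum>i\<in>B. s' i *\<^sub>R x i)"
          using notin that by (simp add: s'_def)
        also have "(\<Sum>i\<in>B. s' i *\<^sub>R x i) = (\<Sum>i\<in>B. s i *\<^sub>R x i)"
          using notin that by (intro sum.cong) (auto simp: s'_def)
        also have "x a + \<dots> \<in> span ?W"
          using xa that by (intro span_add span_base[of "sum _ _"]) auto
        finally show ?thesis .
      qed
      moreover have "U \<subseteq> span ?W" by (auto intro: span_base)
      ultimately show ?thesis using xa by (auto simp: s'_def)
    qed
    ultimately show ?thesis by (metis span_minimal subspace_span top.extremum_uniqueI)
  qed
qed (simp add: subspace_span)

section \<open>Arrangements of type B\<close>

definition wall :: "real \<Rightarrow> 'i \<Rightarrow> 'i \<Rightarrow> ('i \<Rightarrow> real) \<Rightarrow> real" where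
  "wall t i j = (\<lambda>y. y i - t * y j)"

text \<open>The reflection arrangement of type B: the hyperplanes \<open>y i = 0\<close> and
  \<open>y i = t * y j\<close> with \<open>t\<close> a sign. The condition \<open>j < i\<close>
  selects one form per hyperplane and lets all forms involving the largest index be split
  off.\<close>

definition forms_B :: "'i::linorder set \<Rightarrow> (('i \<Rightarrow> real) \<Rightarrow> real) set" where
  "forms_B A = (\<lambda>i y. y i) ` A
     \<union> (\<lambda>(t, i, j). wall t i j) ` {(t, i, j). t \<in> {-1, 1} \<and> i \<in> A \<and> j \<in> A \<and> j < i}"

lemma coordinate_in_forms_B: "i \<in> A \<Longrightarrow> (\<lambda>y. y i) \<in> forms_B A"
  by (simp add: forms_B_def)

lemma wall_in_forms_B: "t \<in> {-1, 1} \<Longrightarrow> i \<in> A \<Longrightarrow> j \<in> A \<Longrightarrow> j < i \<Longrightarrow> wall t i j \<in> forms_B A"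
  by (force simp: forms_B_def)

lemma forms_B_cases:
  assumes "f \<in> forms_B A"
  obtains i where "i \<in> A" "f = (\<lambda>y. y i)"
  | t i j where "t \<in> {-1, 1}" "i \<in> A" "j \<in> A" "j < i" "f = wall t i j"
  using assms by (auto simp: forms_B_def)

lemma forms_B_insert:
  assumes "\<And>i. i \<in> A \<Longrightarrow> i < a"
  shows "forms_B (insert a A)
       = insert (\<lambda>y. y a) (forms_B A) \<union> (\<lambda>(t, j). wall t a j) ` ({-1, 1} \<times> A)"
proof -
  have "\<not> a < i" if "i \<in> A" for i using assms[OF that] by simp
  then have "{(t, i, j). t \<in> {-1, 1::real} \<and> i \<in> insert a A \<and> j \<in> insert a A \<and> j < i}
      = {(t, i, j). t \<in> {-1, 1} \<and> i \<in> A \<and> j \<in> A \<and> j < i} \<union> (\<lambda>(t, j). (t, a, j)) ` ({-1, 1} \<times> A)"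
    using assms by (auto simp: image_iff)
  then show ?thesis
    unfolding forms_B_def by (simp add: image_Un image_image case_prod_unfold Un_assoc)
qed

lemma finite_forms_B:
  assumes "finite A"
  shows "finite (forms_B A)"
proof -
  have "{(t, i, j). t \<in> {-1, 1::real} \<and> i \<in> A \<and> j \<in> A \<and> j < i} \<subseteq> {-1, 1} \<times> A \<times> A" by auto
  then have "finite {(t, i, j). t \<in> {-1, 1::real} \<and> i \<in> A \<and> j \<in> A \<and> j < i}"
    by (rule finite_subset) (use assms in simp)
  then show ?thesis using assms unfolding forms_B_def by blast
qed

lemma linear_form_wall: "linear_form (wall t i j)"
  by (simp add: linear_form_def wall_def algebra_simps)

lemma linear_form_coordinate: "linear_form (\<lambda>y. y i)"
  by (simp add: linear_form_def)

lemma linear_form_B: "f \<in> forms_B A \<Longrightarrow> linear_form f"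
  by (erule forms_B_cases) (simp_all add: linear_form_wall linear_form_coordinate)

text \<open>A region depends on a point only through the values of the forms, so coordinates that no
  form reads may be changed freely.\<close>

lemma regions_cong:
  assumes "\<And>y. y \<in> V \<Longrightarrow> \<exists>z\<in>W. \<forall>f\<in>F. f z = f y" "\<And>z. z \<in> W \<Longrightarrow> \<exists>y\<in>V. \<forall>f\<in>F. f y = f z"
  shows "regions V F = regions W F"
proof -
  have "regions V F \<subseteq> regions W F" if sub: "\<And>y. y \<in> V \<Longrightarrow> \<exists>z\<in>W. \<forall>f\<in>F. f z = f y" for V W
  proof
    fix P assume "P \<in> regions V F"
    then obtain y where y: "y \<in> V" "\<forall>f\<in>F. f y \<noteq> 0" "P = {f \<in> F. f y > 0}"
      by (auto simp: regions_def)
    then obtain z where "z \<in> W" "\<forall>f\<in>F. f z = f y" using sub by blast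
    then have "P = {f \<in> F. f z > 0}" "z \<in> {z \<in> W. \<forall>f\<in>F. f z \<noteq> 0}" using y by auto
    then show "P \<in> regions W F" unfolding regions_def by blast
  qed
  then show ?thesis using assms by (intro equalityI) blast+
qed

lemma span_modulo:
  fixes U :: "'a::euclidean_space set"
  assumes U: "subspace U" and A: "finite A" and sp: "span (U \<union> x ` A) = UNIV"
  shows "\<exists>c. w - (\<Sum>i\<in>A. c i *\<^sub>R x i) \<in> U"
proof -
  let ?S = "{w. \<exists>c. w - (\<Sum>i\<in>A. c i *\<^sub>R x i) \<in> U}"
  have "subspace ?S"
  proof (rule subspaceI)
    show "0 \<in> ?S" using subspace_0[OF U] by (auto intro!: exI[of _ "\<lambda>_. 0"])
  next
    fix v w assume "v \<in> ?S" "w \<in> ?S"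
    then obtain c d where "v - (\<Sum>i\<in>A. c i *\<^sub>R x i) \<in> U" "w - (\<Sum>i\<in>A. d i *\<^sub>R x i) \<in> U" by auto
    from subspace_add[OF U this]
    have "v + w - (\<Sum>i\<in>A. (c i + d i) *\<^sub>R x i) \<in> U"
      by (simp add: scaleR_add_left sum.distrib algebra_simps)
    then show "v + w \<in> ?S" by (intro CollectI exI[of _ "\<lambda>i. c i + d i"])
  next
    fix r w assume "w \<in> ?S"
    then obtain c where "w - (\<Sum>i\<in>A. c i *\<^sub>R x i) \<in> U" by auto
    from subspace_scale[OF U this, of r]
    have "r *\<^sub>R w - (\<Sum>i\<in>A. (r * c i) *\<^sub>R x i) \<in> U"
      by (simp add: scaleR_diff_right scaleR_sum_right)
    then show "r *\<^sub>R w \<in> ?S" by (intro CollectI exI[of _ "\<lambda>i. r * c i"])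
  qed
  moreover have "u \<in> ?S" if "u \<in> U" for u
    using that by (auto intro!: exI[of _ "\<lambda>_. 0"])
  moreover have "x k \<in> ?S" if "k \<in> A" for k
  proof -
    have "(\<Sum>i\<in>A. (if i = k then 1 else 0) *\<^sub>R x i) = (\<Sum>i\<in>A. if i = k then x i else 0)"
      by (intro sum.cong) auto
    also have "\<dots> = x k" using that A by simp
    finally show ?thesis using subspace_0[OF U] by (auto intro!: exI[of _ "\<lambda>i. if i = k then 1 else 0"])
  qed
  ultimately have "span (U \<union> x ` A) \<subseteq> ?S" by (intro span_minimal) auto
  then show ?thesis using sp by auto
qed

text \<open>The extra term is the contribution of \<open>x a\<close> to a relation with
  \<open>y a = t * y j\<close>.\<close>

lemma sum_merge:
  fixes x :: "'i \<Rightarrow> 'a::real_vector" and y :: "'i \<Rightarrow> real"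
  assumes "finite A" "j \<in> A" "a \<notin> A"
  shows "(\<Sum>i\<in>A. y i *\<^sub>R (x(j := x j + t *\<^sub>R x a)) i) = (\<Sum>i\<in>A. y i *\<^sub>R x i) + (t * y j) *\<^sub>R x a"
proof -
  have "(\<Sum>i\<in>A. y i *\<^sub>R (x(j := x j + t *\<^sub>R x a)) i)
      = (\<Sum>i\<in>A. y i *\<^sub>R x i + (if i = j then (t * y j) *\<^sub>R x a else 0))"
    by (intro sum.cong) (auto simp: algebra_simps)
  then show ?thesis using assms by (simp add: sum.distrib)
qed

section \<open>Splitting off the largest coordinate\<close>

context
  fixes U :: "'a::euclidean_space set" and x :: "'i::linorder \<Rightarrow> 'a" and A :: "'i set" and a :: 'i and e :: nat
  assumes A: "finite A" and a: "\<And>i. i \<in> A \<Longrightarrow> i < a" and e: "e \<le> card A"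
    and gen: "generic U x (insert a A) e"
begin

lemma index_notin: "a \<notin> A" using a by blast

lemma relations_insert:
  "y \<in> relations U x (insert a A) \<longleftrightarrow> y a *\<^sub>R x a + (\<Sum>i\<in>A. y i *\<^sub>R x i) \<in> U"
  using A index_notin by (simp add: relations_def)

lemma sum_fun_upd: "(\<Sum>i\<in>A. (y(a := r)) i *\<^sub>R x i) = (\<Sum>i\<in>A. y i *\<^sub>R x i)"
  using index_notin by (intro sum.cong) auto

lemma forms_B_fun_upd: "f \<in> forms_B A \<Longrightarrow> f (y(a := r)) = f y"
  using index_notin by (erule_tac forms_B_cases) (auto simp: wall_def)

lemma regions_drop:
  "regions {y \<in> relations U x (insert a A). y a = 0} (forms_B A) = regions (relations U x A) (forms_B A)"
proof (rule regions_cong)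
  fix z assume z: "z \<in> relations U x A"
  have "z(a := 0) \<in> {y \<in> relations U x (insert a A). y a = 0}"
    using z unfolding mem_Collect_eq relations_insert sum_fun_upd by (simp add: relations_def)
  moreover have "\<forall>f\<in>forms_B A. f (z(a := 0)) = f z"
    by (simp add: forms_B_fun_upd)
  ultimately show "\<exists>y\<in>{y \<in> relations U x (insert a A). y a = 0}. \<forall>f\<in>forms_B A. f y = f z" by blast
next
  fix y assume "y \<in> {y \<in> relations U x (insert a A). y a = 0}"
  then have "y \<in> relations U x A" by (auto simp: relations_insert) (simp add: relations_def)
  then show "\<exists>z\<in>relations U x A. \<forall>f\<in>forms_B A. f z = f y" by blast
qed

lemma regions_merge:
  assumes j: "j \<in> A"
  shows "regions {y \<in> relations U x (insert a A). wall t a j y = 0} (forms_B A)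
       = regions (relations U (x(j := x j + t *\<^sub>R x a)) A) (forms_B A)"
    (is "regions ?V _ = regions ?W _")
proof (rule regions_cong)
  fix z assume z: "z \<in> ?W"
  let ?z = "z(a := t * z j)"
  have "?z \<in> relations U x (insert a A)"
    using z unfolding relations_insert sum_fun_upd
    unfolding relations_def mem_Collect_eq sum_merge[OF A j index_notin]
    by (simp add: add.commute)
  moreover have "wall t a j ?z = 0" using j index_notin by (auto simp: wall_def)
  moreover have "\<forall>f\<in>forms_B A. f ?z = f z"
    by (simp add: forms_B_fun_upd)
  ultimately show "\<exists>y\<in>?V. \<forall>f\<in>forms_B A. f y = f z" by blast
next
  fix y assume "y \<in> ?V"
  then show "\<exists>z\<in>?W. \<forall>f\<in>forms_B A. f z = f y"
    unfolding mem_Collect_eq relations_insert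
    unfolding relations_def mem_Collect_eq sum_merge[OF A j index_notin] wall_def
    by (intro bexI[of _ y]) (auto simp: add.commute)
qed

text \<open>The old forms do not read \<open>y a\<close>, so this coordinate is existentially
  quantified, and a relation modulo \<open>U\<close> with a free coefficient of \<open>x a\<close>
  is a relation modulo \<open>span (insert (x a) U)\<close>.\<close>

lemma regions_project:
  "regions (relations U x (insert a A)) (forms_B A)
   = regions (relations (span (insert (x a) U)) x A) (forms_B A)"
    (is "regions ?V _ = regions ?W _")
proof (rule regions_cong)
  have sU: "span U = U" using generic_subspace[OF gen] by (simp add: span_eq_iff)
  fix z assume "z \<in> ?W"
  then obtain k where k: "(\<Sum>i\<in>A. z i *\<^sub>R x i) - k *\<^sub>R x a \<in> U"
    using sU by (auto simp: relations_def span_insert)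
  have "z(a := -k) \<in> ?V" unfolding relations_insert sum_fun_upd using k by simp
  moreover have "\<forall>f\<in>forms_B A. f (z(a := -k)) = f z"
    by (simp add: forms_B_fun_upd)
  ultimately show "\<exists>y\<in>?V. \<forall>f\<in>forms_B A. f y = f z" by blast
next
  have sU: "span U = U" using generic_subspace[OF gen] by (simp add: span_eq_iff)
  fix y assume "y \<in> ?V"
  then have "(\<Sum>i\<in>A. y i *\<^sub>R x i) - (- y a) *\<^sub>R x a \<in> span U"
    unfolding relations_insert sU by (simp only: scaleR_minus_left diff_minus_eq_add add.commute)
  then have "y \<in> ?W" unfolding relations_def span_insert by blast
  then show "\<exists>z\<in>?W. \<forall>f\<in>forms_B A. f z = f y" by blast
qed

text \<open>Because \<open>e \<le> card A\<close>, the vectors with index in \<open>A\<close>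
  already span modulo \<open>U\<close>; expressing \<open>x a\<close> through them gives a relation
  with \<open>y a = 1\<close>.\<close>

lemma coordinate_nonzero: "\<exists>v\<in>relations U x (insert a A). v a \<noteq> 0"
proof -
  have "generic U x A e" using generic_remove[OF gen, of a] index_notin by simp
  from span_modulo[OF generic_subspace[OF gen] A generic_span[OF this A e], of "x a"]
  obtain c where c: "x a - (\<Sum>i\<in>A. c i *\<^sub>R x i) \<in> U" by blast
  have "(\<lambda>i. - c i)(a := 1) \<in> relations U x (insert a A)"
    unfolding relations_insert sum_fun_upd using c by (simp add: sum_negf)
  then show ?thesis by (rule bexI[rotated]) simp
qed

lemma wall_nonzero:
  assumes j: "j \<in> A" and t: "t \<in> {-1, 1}"
  shows "\<exists>v\<in>relations U x (insert a A). wall t a j v \<noteq> 0"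
proof -
  have "generic U (x(j := x j + t *\<^sub>R x a)) (insert a A - {a}) e"
    by (rule generic_merge) (use gen A j t index_notin in auto)
  then have "generic U (x(j := x j + t *\<^sub>R x a)) A e" using index_notin by simp
  from span_modulo[OF generic_subspace[OF gen] A generic_span[OF this A e], of "x a"]
  obtain c where "x a - (\<Sum>i\<in>A. c i *\<^sub>R (x(j := x j + t *\<^sub>R x a)) i) \<in> U"
    by blast
  then have c: "x a - ((\<Sum>i\<in>A. c i *\<^sub>R x i) + (t * c j) *\<^sub>R x a) \<in> U"
    by (simp only: sum_merge[OF A j index_notin])
  \<comment> \<open>The coefficient at \<open>a\<close> collects both occurrences of
    \<open>x a\<close>, and it makes the wall evaluate to
    \<open>(1 - t * c j) + t * c j = 1\<close>.\<close>
  let ?v = "(\<lambda>i. - c i)(a := 1 - t * c j)"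
  have "?v \<in> relations U x (insert a A)"
    unfolding relations_insert sum_fun_upd using c by (simp add: sum_negf algebra_simps)
  moreover have "wall t a j ?v \<noteq> 0" using j index_notin by (auto simp: wall_def)
  ultimately show ?thesis by blast
qed

text \<open>Substituting \<open>y a = t * y j\<close> turns \<open>y a - s * y i\<close> into
  \<open>t * y j - s * y i\<close>. For \<open>i = j\<close> the signs differ and
  \<open>2 * t * y j\<close> remains; otherwise, as squares of signs are 1, it is \<open>t\<close>
  or \<open>- s\<close> times an old wall with its larger index first.\<close>

lemma wall_proportional:
  assumes "j \<in> A" "i \<in> A" "t \<in> {-1, 1}" "s \<in> {-1, 1}" "(s, i) \<noteq> (t, j)"
  shows "\<exists>g\<in>forms_B A. \<exists>c. c \<noteq> 0 \<and> (\<forall>y. wall t a j y = 0 \<longrightarrow> wall s a i y = c * g y)"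
proof -
  have ts: "t * t = 1" "s * s = 1" "t \<noteq> 0" "s \<noteq> 0" using assms by auto
  consider "i = j" | "i < j" | "j < i" by fastforce
  then show ?thesis
  proof cases
    case 1
    then have "s = - t" using assms by auto
    then have "wall t a j y = 0 \<longrightarrow> wall s a i y = (2 * t) * y j" for y using 1 by (simp add: wall_def)
    then show ?thesis using assms ts
      by (intro bexI[OF _ coordinate_in_forms_B[of j]] exI[of _ "2 * t"]) auto
  next
    case 2
    have eq: "wall t a j y = 0 \<longrightarrow> wall s a i y = t * wall (t * s) j i y" for y
    proof -
      have "t * (t * s * y i) = s * y i" using ts by (metis mult.assoc mult.left_neutral)
      then show ?thesis by (simp add: wall_def right_diff_distrib)
    qed
    have "t * s \<in> {-1, 1}" using assms by auto
    then have "wall (t * s) j i \<in> forms_B A" using assms 2 by (intro wall_in_forms_B)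
    then show ?thesis using eq ts by blast
  next
    case 3
    have eq: "wall t a j y = 0 \<longrightarrow> wall s a i y = (- s) * wall (t * s) i j y" for y
    proof -
      have "s * (t * s * y j) = t * y j" using ts by (metis mult.assoc mult.commute mult.left_neutral)
      then show ?thesis by (simp add: wall_def right_diff_distrib)
    qed
    have "t * s \<in> {-1, 1}" using assms by auto
    then have "wall (t * s) i j \<in> forms_B A" using assms 3 by (intro wall_in_forms_B)
    moreover have "- s \<noteq> 0" using ts by simp
    ultimately show ?thesis using eq by blast
  qed
qed

text \<open>Induction on the walls already added. The start adds only \<open>y a = 0\<close>, which
  accounts for the projected and the dropped arrangement. Each further wall contributes its
  restriction, where all earlier new forms are redundant by
  \<open>wall_proportional\<close>.\<close>

lemma card_regions_walls:
  assumes "K \<subseteq> {-1, 1} \<times> A"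
  shows "card (regions (relations U x (insert a A))
            (insert (\<lambda>y. y a) (forms_B A) \<union> (\<lambda>(t, j). wall t a j) ` K))
       = card (regions (relations (span (insert (x a) U)) x A) (forms_B A))
       + card (regions (relations U x A) (forms_B A))
       + (\<Sum>(t, j)\<in>K. card (regions (relations U (x(j := x j + t *\<^sub>R x a)) A) (forms_B A)))"
proof -
  let ?L = "relations U x (insert a A)"
  have L: "linear_set ?L" by (intro linear_set_relations generic_subspace[OF gen])
  have sub: "linear_set {y \<in> ?L. h y = 0}" if "linear_form h" for h
    using L that by (simp add: linear_set_def linear_form_def)
  have fin: "finite (forms_B A)" using A by (rule finite_forms_B)
  have "finite K" using assms A finite_subset by blast
  then show ?thesis using assms
  proof (induction K)
    case empty
    obtain v where "v \<in> ?L" "v a \<noteq> 0" using coordinate_nonzero by blast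
    then show ?case
      using deletion_restriction[OF fin linear_form_B linear_form_coordinate[of a] L, where v = v]
      by (simp add: regions_drop regions_project)
  next
    case (insert p K)
    obtain t j where p: "p = (t, j)" by force
    have j: "j \<in> A" "t \<in> {-1, 1}" using insert.prems p by auto
    let ?F = "insert (\<lambda>y. y a) (forms_B A) \<union> (\<lambda>(t, j). wall t a j) ` K"
    \<comment> \<open>These are the forms already added that involve \<open>a\<close>; on the
      hyperplane \<open>?V\<close> each is a nonzero multiple of an old form.\<close>
    let ?K' = "insert (\<lambda>y. y a) ((\<lambda>(t, j). wall t a j) ` K)"
    have finF: "finite ?F" using fin insert by simp
    have linF: "linear_form f" if "f \<in> ?F" for f
      using that linear_form_B linear_form_coordinate linear_form_wall by auto
    obtain v where v: "v \<in> ?L" "wall t a j v \<noteq> 0" using wall_nonzero j by blast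
    let ?V = "{y \<in> ?L. wall t a j y = 0}"
    have "card (regions ?V (forms_B A \<union> ?K')) = card (regions ?V (forms_B A))"
    proof (rule card_regions_proportional)
      fix f assume f: "f \<in> ?K'"
      show "\<exists>g\<in>forms_B A. \<exists>c. c \<noteq> 0 \<and> (\<forall>y\<in>?V. f y = c * g y)"
      proof (cases "f = (\<lambda>y. y a)")
        case True
        have "t \<noteq> 0" using j by auto
        then show ?thesis using True
          by (intro bexI[OF _ coordinate_in_forms_B[OF j(1)]] exI[of _ t]) (auto simp: wall_def)
      next
        case False
        then obtain s i where si: "(s, i) \<in> K" "f = wall s a i" using f by auto
        then have "i \<in> A" "s \<in> {-1, 1}" "(s, i) \<noteq> (t, j)" using insert p by auto
        from wall_proportional[OF j(1) this(1) j(2) this(2,3)]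
        show ?thesis using si by blast
      qed
    qed (use fin insert.hyps linF sub[OF linear_form_wall] in auto)
    moreover have "forms_B A \<union> ?K' = ?F" by auto
    ultimately have "card (regions ?V ?F)
        = card (regions (relations U (x(j := x j + t *\<^sub>R x a)) A) (forms_B A))"
      using regions_merge[OF j(1)] by simp
    moreover have "card (regions ?L (insert (wall t a j) ?F)) = card (regions ?L ?F) + card (regions ?V ?F)"
      by (rule deletion_restriction[where v = v]) (use finF linF L v linear_form_wall in auto)
    ultimately show ?case using insert p by (simp add: fun_upd_def)
  qed
qed

lemma card_regions_recursion:
  "card (regions (relations U x (insert a A)) (forms_B (insert a A)))
   = card (regions (relations (span (insert (x a) U)) x A) (forms_B A))
   + card (regions (relations U x A) (forms_B A))
   + (\<Sum>(t, j)\<in>{-1, 1} \<times> A. card (regions (relations U (x(j := x j + t *\<^sub>R x a)) A) (forms_B A)))"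
proof -
  have "forms_B (insert a A)
      = insert (\<lambda>y. y a) (forms_B A) \<union> (\<lambda>(t, j). wall t a j) ` ({-1, 1} \<times> A)"
    by (rule forms_B_insert) (rule a)
  with card_regions_walls[OF subset_refl] show ?thesis by simp
qed

end

section \<open>Recursion for the coefficients and their tails with step two\<close>

lemma B_coeff_0: "B_coeff 0 k = (if k = 0 then 1 else 0)"
  by (simp add: B_coeff_def)

lemma B_coeff_Suc:
  "B_coeff (Suc n) k = (if k = 0 then 0 else B_coeff n (k - 1)) + (2 * n + 1) * B_coeff n k"
proof -
  have "(\<Prod>i\<in>{1..Suc n}. [:2 * i - 1, 1:]) = (\<Prod>i\<in>{1..n}. [:2 * i - 1, 1:]) * [:2 * n + 1, 1:]"
    by (simp add: mult.commute)
  then show ?thesis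
    unfolding B_coeff_def by (simp add: coeff_pCons split: nat.splits)
qed

lemma B_coeff_eq_0: "n < k \<Longrightarrow> B_coeff n k = 0"
  by (induction n arbitrary: k) (auto simp: B_coeff_0 B_coeff_Suc)

text \<open>The series \<open>B(n,k) + B(n,k+2) + ...\<close>. Cutting it off at
  \<open>j = n\<close> loses nothing, since coefficients of index above \<open>n\<close>
  vanish.\<close>

definition B_tail :: "nat \<Rightarrow> nat \<Rightarrow> nat" where
  "B_tail n k = (\<Sum>j\<le>n. B_coeff n (k + 2 * j))"

lemma B_tail_eq_0: "n < k \<Longrightarrow> B_tail n k = 0"
  by (simp add: B_tail_def B_coeff_eq_0)

lemma B_tail_Suc_Suc: "B_tail (Suc n) (Suc k) = B_tail n k + (2 * n + 1) * B_tail n (Suc k)"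
proof -
  have "B_tail (Suc n) (Suc k) = (\<Sum>j\<le>Suc n. B_coeff n (k + 2 * j) + (2 * n + 1) * B_coeff n (Suc k + 2 * j))"
    unfolding B_tail_def by (intro sum.cong) (simp_all add: B_coeff_Suc)
  also have "\<dots> = (\<Sum>j\<le>n. B_coeff n (k + 2 * j) + (2 * n + 1) * B_coeff n (Suc k + 2 * j))"
    by (simp add: B_coeff_eq_0)
  finally show ?thesis by (simp add: B_tail_def sum.distrib sum_distrib_left)
qed

text \<open>The coefficient of index 0 receives nothing from a lower index; shifting the remaining
  even indices down by one therefore gives the tail starting at 1.\<close>

lemma B_tail_Suc_0: "B_tail (Suc n) 0 = B_tail n 1 + (2 * n + 1) * B_tail n 0"
proof -
  have "(\<Sum>j\<le>Suc n. B_coeff (Suc n) (2 * j)) = B_coeff (Suc n) 0 + (\<Sum>j\<le>n. B_coeff (Suc n) (2 * Suc j))"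
    by (subst sum.atMost_Suc_shift) simp
  also have "(\<Sum>j\<le>n. B_coeff (Suc n) (2 * Suc j))
      = B_tail n 1 + (2 * n + 1) * (\<Sum>j\<le>n. B_coeff n (2 * Suc j))"
    by (simp add: B_tail_def B_coeff_Suc sum.distrib sum_distrib_left)
  also have "B_coeff (Suc n) 0 = (2 * n + 1) * B_coeff n 0" by (simp add: B_coeff_Suc)
  also have "(2 * n + 1) * B_coeff n 0 + (B_tail n 1 + (2 * n + 1) * (\<Sum>j\<le>n. B_coeff n (2 * Suc j)))
      = B_tail n 1 + (2 * n + 1) * (B_coeff n 0 + (\<Sum>j\<le>n. B_coeff n (2 * Suc j)))"
    by (simp add: algebra_simps)
  also have "B_coeff n 0 + (\<Sum>j\<le>n. B_coeff n (2 * Suc j)) = (\<Sum>j\<le>Suc n. B_coeff n (2 * j))"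
    by (subst sum.atMost_Suc_shift) simp
  also have "\<dots> = B_tail n 0" by (simp add: B_tail_def B_coeff_eq_0)
  finally show ?thesis by (simp add: B_tail_def)
qed

text \<open>The factor \<open>t + 1\<close> makes the generating polynomial vanish at \<open>-1\<close>.\<close>
lemma B_tail_0_eq_1: "B_tail (Suc n) 0 = B_tail (Suc n) 1"
proof (induction n)
  case 0
  then show ?case by (simp add: B_tail_def B_coeff_Suc B_coeff_0)
next
  case (Suc n)
  then show ?case using B_tail_Suc_0[of "Suc n"] B_tail_Suc_Suc[of "Suc n" 0] by simp
qed

lemma regions_no_forms: "V \<noteq> {} \<Longrightarrow> card (regions V {}) = 1"
  by (simp add: regions_def image_constant_conv)

text \<open>Induction on \<open>card A\<close>, splitting off the maximum. Nonemptiness of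
  \<open>A\<close> matters: with no coordinates there is one region, while the formula would give
  0.\<close>

lemma card_regions_generic:
  fixes U :: "'a::euclidean_space set" and x :: "'i::linorder \<Rightarrow> 'a"
  assumes "finite A" "A \<noteq> {}" "e \<le> card A" "generic U x A e"
  shows "card (regions (relations U x A) (forms_B A)) = 2 * B_tail (card A) (e + 1)"
proof -
  show ?thesis using assms
  proof (induction "card A" arbitrary: A U x e)
    case 0
    then show ?case by simp
  next
    case (Suc m)
    have U: "subspace U" "dim U + e \<le> DIM('a)" using Suc.prems(4) by (auto simp: generic_def)
    show ?case
    proof (cases "e = card A")
      \<comment> \<open>In full codimension a relation vanishes on all of \<open>A\<close>, so no
        regular point exists; the tail starts at \<open>card A + 1\<close> and is 0 as well.\<close>
      case True
      have "\<forall>i\<in>A. y i = 0" if "y \<in> relations U x A" for y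
      proof (rule independent_modulo)
        show "span (U \<union> x ` A) = UNIV" by (rule generic_span) (use Suc.prems True in auto)
      qed (use Suc.prems that U True in \<open>auto simp: relations_def\<close>)
      moreover obtain i where "i \<in> A" using Suc.prems by auto
      ultimately have "regions (relations U x A) (forms_B A) = {}"
        using coordinate_in_forms_B[of i A] unfolding regions_def by fastforce
      then show ?thesis using True by (simp add: B_tail_eq_0)
    next
      case False
      define a where "a = Max A"
      define A' where "A' = A - {a}"
      have "a \<in> A" unfolding a_def by (rule Max_in) (use Suc.prems in auto)
      then have a: "a \<in> A" "A = insert a A'" "a \<notin> A'" "finite A'" using Suc.prems by (auto simp: A'_def)
      have less: "i < a" if "i \<in> A'" for i
        using that Suc.prems by (auto simp: a_def A'_def intro: le_neq_trans)
      have m: "m = card A'" using Suc.hyps(2) a by (metis card_insert_disjoint nat.inject)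
      have e: "e \<le> card A'" using False Suc.prems(3) Suc.hyps(2) m by simp
      have gen: "generic U x (insert a A') e" using Suc.prems(4) a(2) by simp
      note rec = card_regions_recursion[OF a(4) less e gen]
      have gen1: "generic (span (insert (x a) U)) x A' (e - 1)"
        and gen2: "generic U x A' e"
        and gen3: "j \<in> A' \<Longrightarrow> t \<in> {-1, 1} \<Longrightarrow> generic U (x(j := x j + t *\<^sub>R x a)) A' e" for j t
        using generic_project[OF Suc.prems(4,1) a(1)] generic_remove[OF Suc.prems(4), of a]
          generic_merge[OF Suc.prems(4,1) a(1), of j t] by (auto simp: A'_def)
      show ?thesis
      proof (cases "A' = {}")
        case True
        have "relations V x {} \<noteq> {}" if "subspace V" for V :: "'a set"
          using subspace_0[OF that] by (auto simp: relations_def)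
        moreover have "forms_B A' = {}" using True by (simp add: forms_B_def)
        ultimately have "card (regions (relations U x A) (forms_B A)) = 2"
          using rec U(1) True a(2) by (simp add: regions_no_forms subspace_span)
        moreover have "e = 0" "card A = 1" using e True a(2) by auto
        ultimately show ?thesis by (simp add: B_tail_def B_coeff_Suc B_coeff_0)
      next
        case nonempty: False
        then obtain m' where m': "m = Suc m'" using m a(4) by (metis card_0_eq not0_implies_Suc)
        have "card (regions (relations U (x(j := x j + t *\<^sub>R x a)) A') (forms_B A')) = 2 * B_tail m (e + 1)"
          if "j \<in> A'" "t \<in> {-1, 1}" for j t
          using Suc.hyps(1)[OF m a(4) nonempty e gen3[OF that]] m by simp
        then have "(\<Sum>(t, j)\<in>{-1, 1} \<times> A'. card (regions (relations U (x(j := x j + t *\<^sub>R x a)) A') (forms_B A')))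
            = (\<Sum>(t, j)\<in>{-1, 1 :: real} \<times> A'. 2 * B_tail m (e + 1))"
          by (intro sum.cong) auto
        also have "\<dots> = 2 * m * (2 * B_tail m (e + 1))"
          by (simp add: case_prod_unfold card_cartesian_product m)
        finally have "card (regions (relations U x A) (forms_B A))
            = 2 * B_tail m (e - 1 + 1) + 2 * B_tail m (e + 1) + 2 * m * (2 * B_tail m (e + 1))"
          using rec Suc.hyps(1)[OF m a(4) nonempty e gen2] Suc.hyps(1)[OF m a(4) nonempty _ gen1] e m a(2)
          by simp
        \<comment> \<open>For \<open>e = 0\<close> the truncated difference produces the tail at 1
          where the recursion needs the tail at 0; the two agree because \<open>m\<close> is
          positive.\<close>
        also have "B_tail m (e - 1 + 1) = B_tail m e"
          using B_tail_0_eq_1[of m'] m' by (cases e) auto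
        finally show ?thesis
          using B_tail_Suc_Suc[of m e] Suc.hyps(2)[symmetric] by (simp add: algebra_simps)
      qed
    qed
  qed
qed

section \<open>Weyl chambers and signed permutations\<close>

text \<open>The rank \<open>r k\<close>, the number of keys not exceeding that of \<open>k\<close>,
  is a permutation when extended by the identity; its inverse lists the indices by increasing
  key.\<close>

lemma sorting_permutation:
  fixes \<kappa> :: "nat \<Rightarrow> real"
  assumes inj: "inj_on \<kappa> {1..n}"
  obtains \<sigma> where "\<sigma> permutes {1..n}"
    "\<And>i j. i \<in> {1..n} \<Longrightarrow> j \<in> {1..n} \<Longrightarrow> i < j \<Longrightarrow> \<kappa> (\<sigma> i) < \<kappa> (\<sigma> j)"
proof -
  define r where "r k = (if k \<in> {1..n} then card {j\<in>{1..n}. \<kappa> j \<le> \<kappa> k} else k)" for k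
  have mono: "r k \<le> r l" if "k \<in> {1..n}" "l \<in> {1..n}" "\<kappa> k \<le> \<kappa> l" for k l
    using that unfolding r_def by (auto intro!: card_mono)
  have strict: "r k < r l" if "k \<in> {1..n}" "l \<in> {1..n}" "\<kappa> k < \<kappa> l" for k l
  proof -
    have "{j\<in>{1..n}. \<kappa> j \<le> \<kappa> k} \<subset> {j\<in>{1..n}. \<kappa> j \<le> \<kappa> l}"
    proof
      show "{j\<in>{1..n}. \<kappa> j \<le> \<kappa> k} \<subseteq> {j\<in>{1..n}. \<kappa> j \<le> \<kappa> l}" using that(3) by auto
      have "l \<in> {j\<in>{1..n}. \<kappa> j \<le> \<kappa> l}" "l \<notin> {j\<in>{1..n}. \<kappa> j \<le> \<kappa> k}" using that by auto
      then show "{j\<in>{1..n}. \<kappa> j \<le> \<kappa> k} \<noteq> {j\<in>{1..n}. \<kappa> j \<le> \<kappa> l}" by metis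
    qed
    then have "card {j\<in>{1..n}. \<kappa> j \<le> \<kappa> k} < card {j\<in>{1..n}. \<kappa> j \<le> \<kappa> l}"
      by (intro psubset_card_mono) auto
    then show ?thesis using that by (simp add: r_def)
  qed
  have "inj_on r {1..n}"
  proof (rule inj_onI)
    fix k l assume kl: "k \<in> {1..n}" "l \<in> {1..n}" "r k = r l"
    then have "\<not> \<kappa> k < \<kappa> l" "\<not> \<kappa> l < \<kappa> k" using strict[of k l] strict[of l k] by auto
    then have "\<kappa> k = \<kappa> l" by linarith
    then show "k = l" using inj_onD[OF inj] kl by blast
  qed
  moreover have "r ` {1..n} \<subseteq> {1..n}"
  proof
    fix m assume "m \<in> r ` {1..n}"
    then obtain k where k: "k \<in> {1..n}" "m = r k" by auto
    have "card {j\<in>{1..n}. \<kappa> j \<le> \<kappa> k} \<le> card {1..n}" by (intro card_mono) auto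
    moreover have "card {j\<in>{1..n}. \<kappa> j \<le> \<kappa> k} > 0" using k by (auto simp: card_gt_0_iff)
    ultimately show "m \<in> {1..n}" using k by (simp add: r_def)
  qed
  ultimately have "bij_betw r {1..n} {1..n}"
    by (simp add: bij_betw_def endo_inj_surj)
  then have r: "r permutes {1..n}" by (rule bij_imp_permutes) (auto simp: r_def)
  show ?thesis
  proof (rule that[OF permutes_inv[OF r]])
    fix i j assume ij: "i \<in> {1..n}" "j \<in> {1..n}" "i < j"
    let ?k = "inv r i" and ?l = "inv r j"
    have "?k \<in> {1..n}" "?l \<in> {1..n}" using ij permutes_in_image[OF permutes_inv[OF r]] by auto
    moreover have "r ?k = i" "r ?l = j" using permutes_inverses[OF r] by auto
    ultimately show "\<kappa> ?k < \<kappa> ?l" using mono[of ?l ?k] ij(3) by (metis not_le_imp_less not_less)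
  qed
qed

text \<open>The sign functions are extensional, so each signed permutation occurs once and the set
  is finite.\<close>

definition signed_perms :: "nat \<Rightarrow> ((nat \<Rightarrow> nat) \<times> (nat \<Rightarrow> real)) set" where
  "signed_perms n = {\<sigma>. \<sigma> permutes {1..n}} \<times> ({1..n} \<rightarrow>\<^sub>E {-1, 1})"

lemma card_signed_perms: "card (signed_perms n) = 2 ^ n * fact n"
  by (simp add: signed_perms_def card_cartesian_product card_permutations card_PiE numeral_2_eq_2)

lemma finite_signed_perms: "finite (signed_perms n)"
  unfolding signed_perms_def by (intro finite_cartesian_product finite_permutations finite_PiE) auto

text \<open>The numbers \<open>\<epsilon> i * y (\<sigma> i)\<close> are positive and strictly
  decreasing in \<open>i\<close>, so that their consecutive differences are positive weights for the
  partial sums.\<close>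

definition chamber :: "nat \<Rightarrow> (nat \<Rightarrow> nat) \<times> (nat \<Rightarrow> real) \<Rightarrow> (nat \<Rightarrow> real) set" where
  "chamber n = (\<lambda>(\<sigma>, \<epsilon>). {y. (\<forall>i\<in>{1..n}. \<epsilon> i * y (\<sigma> i) > 0) \<and>
     (\<forall>i\<in>{1..n}. \<forall>j\<in>{1..n}. i < j \<longrightarrow> \<epsilon> j * y (\<sigma> j) < \<epsilon> i * y (\<sigma> i))})"

lemma sign_mult_pos:
  fixes e a :: real
  assumes "e \<in> {-1, 1}"
  shows "e * a > 0 \<longleftrightarrow> sgn a = e" "e * a > 0 \<Longrightarrow> e * a = \<bar>a\<bar>"
  using assms by (auto simp: sgn_if)

lemma mem_chamber_iff:
  assumes "(\<sigma>, \<epsilon>) \<in> signed_perms n"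
  shows "y \<in> chamber n (\<sigma>, \<epsilon>) \<longleftrightarrow> (\<forall>i\<in>{1..n}. sgn (y (\<sigma> i)) = \<epsilon> i) \<and>
     (\<forall>i\<in>{1..n}. \<forall>j\<in>{1..n}. i < j \<longrightarrow> \<bar>y (\<sigma> j)\<bar> < \<bar>y (\<sigma> i)\<bar>)"
proof -
  have e: "\<epsilon> i \<in> {-1, 1}" if "i \<in> {1..n}" for i using assms that by (auto simp: signed_perms_def)
  have "\<epsilon> i * y (\<sigma> i) > 0 \<longleftrightarrow> sgn (y (\<sigma> i)) = \<epsilon> i" if "i \<in> {1..n}" for i
    using sign_mult_pos(1)[OF e[OF that]] .
  moreover have "\<epsilon> i * y (\<sigma> i) = \<bar>y (\<sigma> i)\<bar>" if "i \<in> {1..n}" "sgn (y (\<sigma> i)) = \<epsilon> i" for i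
    using sign_mult_pos[OF e[OF that(1)], of "y (\<sigma> i)"] that(2) by simp
  ultimately show ?thesis unfolding chamber_def by auto
qed

text \<open>The point determines its chamber: \<open>\<sigma> m\<close> is the index at which
  exactly \<open>m\<close> coordinates are at least as large in absolute value, and
  \<open>\<epsilon> m\<close> is the sign there.\<close>

lemma chamber_unique:
  assumes g: "(\<sigma>, \<epsilon>) \<in> signed_perms n" "y \<in> chamber n (\<sigma>, \<epsilon>)"
    and h: "(\<tau>, \<delta>) \<in> signed_perms n" "y \<in> chamber n (\<tau>, \<delta>)"
  shows "(\<sigma>, \<epsilon>) = (\<tau>, \<delta>)"
proof -
  define r where "r k = card {j\<in>{1..n}. \<bar>y k\<bar> \<le> \<bar>y j\<bar>}" for k
  have r: "r (\<sigma> m) = m" if g: "(\<sigma>, \<epsilon>) \<in> signed_perms n" "y \<in> chamber n (\<sigma>, \<epsilon>)" and m: "m \<in> {1..n}"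
    for \<sigma> \<epsilon> m
  proof -
    have s: "\<sigma> permutes {1..n}" using g by (simp add: signed_perms_def)
    have lt: "\<bar>y (\<sigma> j)\<bar> < \<bar>y (\<sigma> i)\<bar>" if "i \<in> {1..n}" "j \<in> {1..n}" "i < j" for i j
      using g(2) that unfolding mem_chamber_iff[OF g(1)] by blast
    have "{j\<in>{1..n}. \<bar>y (\<sigma> m)\<bar> \<le> \<bar>y j\<bar>} = \<sigma> ` {1..m}"
    proof (intro equalityI subsetI)
      fix j assume j: "j \<in> {j\<in>{1..n}. \<bar>y (\<sigma> m)\<bar> \<le> \<bar>y j\<bar>}"
      then have "j \<in> \<sigma> ` {1..n}" using permutes_image[OF s] by simp
      then obtain i where i: "i \<in> {1..n}" "j = \<sigma> i" by auto
      then have "\<not> m < i" using lt[of m i] m j by auto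
      then show "j \<in> \<sigma> ` {1..m}" using i by auto
    next
      fix j assume "j \<in> \<sigma> ` {1..m}"
      then obtain i where i: "i \<in> {1..m}" "j = \<sigma> i" by auto
      then have "j \<in> {1..n}" using m permutes_in_image[OF s, of i] by auto
      moreover have "\<bar>y (\<sigma> m)\<bar> \<le> \<bar>y j\<bar>" using lt[of i m] i m by (cases "i = m") auto
      ultimately show "j \<in> {j\<in>{1..n}. \<bar>y (\<sigma> m)\<bar> \<le> \<bar>y j\<bar>}" by simp
    qed
    moreover have "inj_on \<sigma> {1..m}" using permutes_inj[OF s] by (rule inj_on_subset) simp
    ultimately show ?thesis by (simp add: r_def card_image)
  qed
  have s: "\<sigma> permutes {1..n}" "\<tau> permutes {1..n}" using g h by (auto simp: signed_perms_def)
  have "\<sigma> m = \<tau> m" for m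
  proof (cases "m \<in> {1..n}")
    case True
    then have "\<sigma> m \<in> \<tau> ` {1..n}" using s permutes_in_image permutes_image by metis
    then obtain l where l: "l \<in> {1..n}" "\<sigma> m = \<tau> l" by auto
    then have "m = l" using r[OF g True] r[OF h l(1)] by simp
    then show ?thesis using l by simp
  next
    case False
    then show ?thesis using s by (simp add: permutes_not_in)
  qed
  then have eq: "\<sigma> = \<tau>" by auto
  have "\<epsilon> = \<delta>"
  proof (rule PiE_ext)
    show "\<epsilon> \<in> {1..n} \<rightarrow>\<^sub>E {-1, 1}" "\<delta> \<in> {1..n} \<rightarrow>\<^sub>E {-1, 1}"
      using g h by (auto simp: signed_perms_def)
    fix i assume "i \<in> {1..n}"
    then have "sgn (y (\<sigma> i)) = \<epsilon> i" "sgn (y (\<tau> i)) = \<delta> i"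
      using g(2)[unfolded mem_chamber_iff[OF g(1)]] h(2)[unfolded mem_chamber_iff[OF h(1)]] by blast+
    then show "\<epsilon> i = \<delta> i" using eq by simp
  qed
  with eq show ?thesis by simp
qed

lemma regular_iff:
  fixes y :: "'i::linorder \<Rightarrow> real"
  shows "(\<forall>f\<in>forms_B A. f y \<noteq> 0) \<longleftrightarrow> (\<forall>i\<in>A. y i \<noteq> 0) \<and> (\<forall>i\<in>A. \<forall>j\<in>A. i \<noteq> j \<longrightarrow> \<bar>y i\<bar> \<noteq> \<bar>y j\<bar>)"
    (is "?L \<longleftrightarrow> ?R")
proof
  assume L: ?L
  have "\<bar>y i\<bar> \<noteq> \<bar>y j\<bar>" if "i \<in> A" "j \<in> A" "j < i" for i j
  proof -
    have "wall 1 i j y \<noteq> 0" "wall (-1) i j y \<noteq> 0"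
      using L wall_in_forms_B[of _ i A j] that by blast+
    then show ?thesis by (auto simp: wall_def abs_if)
  qed
  then have "\<bar>y i\<bar> \<noteq> \<bar>y j\<bar>" if "i \<in> A" "j \<in> A" "i \<noteq> j" for i j
    using that by (metis linorder_neqE)
  moreover have "y i \<noteq> 0" if "i \<in> A" for i
    using bspec[OF L coordinate_in_forms_B[OF that]] by simp
  ultimately show ?R by blast
next
  assume R: ?R
  show ?L
  proof
    fix f assume "f \<in> forms_B A"
    then show "f y \<noteq> 0"
    proof (cases rule: forms_B_cases)
      case (2 t i j)
      then have "i \<noteq> j" by auto
      then have "\<bar>y i\<bar> \<noteq> \<bar>y j\<bar>" using R 2 by blast
      then show ?thesis using 2 by (auto simp: wall_def)
    qed (use R in auto)
  qed
qed

text \<open>A sign pattern of the forms of type B records exactly the signs of the coordinates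
  and the order of their absolute values.\<close>

lemma same_signs_iff:
  fixes y z :: "'i::linorder \<Rightarrow> real"
  assumes y: "\<forall>f\<in>forms_B A. f y \<noteq> 0" and z: "\<forall>f\<in>forms_B A. f z \<noteq> 0"
  shows "{f\<in>forms_B A. f y > 0} = {f\<in>forms_B A. f z > 0} \<longleftrightarrow>
    (\<forall>i\<in>A. sgn (y i) = sgn (z i)) \<and> (\<forall>i\<in>A. \<forall>j\<in>A. \<bar>y i\<bar> < \<bar>y j\<bar> \<longleftrightarrow> \<bar>z i\<bar> < \<bar>z j\<bar>)"
    (is "?L \<longleftrightarrow> ?R")
proof
  assume L: ?L
  have sg: "sgn (f y) = sgn (f z)" if f: "f \<in> forms_B A" for f
  proof -
    have "f y > 0 \<longleftrightarrow> f z > 0" using L f by blast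
    moreover have "f y \<noteq> 0" "f z \<noteq> 0" using y z f by auto
    ultimately show ?thesis by (auto simp: sgn_if)
  qed
  have cmp: "\<bar>y j\<bar> < \<bar>y i\<bar> \<longleftrightarrow> \<bar>z j\<bar> < \<bar>z i\<bar>" if "i \<in> A" "j \<in> A" "j < i" for i j
  proof -
    have w: "wall t i j \<in> forms_B A" if "t \<in> {-1, 1}" for t
      using wall_in_forms_B[OF that \<open>i \<in> A\<close> \<open>j \<in> A\<close> \<open>j < i\<close>] .
    \<comment> \<open>The product of the two walls is \<open>(y i - y j) * (y i + y j)\<close>, the
      difference of the squares, so their signs together decide the comparison of absolute
      values.\<close>
    have "\<bar>y j\<bar> < \<bar>y i\<bar> \<longleftrightarrow> sgn (wall 1 i j y * wall (-1) i j y) = 1" for y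
    proof -
      have "\<bar>y j\<bar> < \<bar>y i\<bar> \<longleftrightarrow> (y j)\<^sup>2 < (y i)\<^sup>2"
        by (metis abs_le_square_iff not_le)
      also have "(y j)\<^sup>2 < (y i)\<^sup>2 \<longleftrightarrow> wall 1 i j y * wall (-1) i j y > 0"
        by (simp add: wall_def algebra_simps power2_eq_square)
      finally show ?thesis by (simp add: sgn_1_pos)
    qed
    then show ?thesis using sg[OF w, of 1] sg[OF w, of "-1"] by (simp add: sgn_mult)
  qed
  have "\<bar>y i\<bar> < \<bar>y j\<bar> \<longleftrightarrow> \<bar>z i\<bar> < \<bar>z j\<bar>" if ij: "i \<in> A" "j \<in> A" for i j
  proof (rule linorder_cases[of i j])
    assume "i < j"
    then show ?thesis using cmp[of j i] ij by simp
  next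
    assume ji: "j < i"
    have "\<bar>y i\<bar> \<noteq> \<bar>y j\<bar>" "\<bar>z i\<bar> \<noteq> \<bar>z j\<bar>" using y z ij ji unfolding regular_iff by auto
    then show ?thesis using cmp[of i j] ij ji by linarith
  qed simp
  moreover have "sgn (y i) = sgn (z i)" if "i \<in> A" for i
    using sg[OF coordinate_in_forms_B[OF that]] .
  ultimately show ?R by blast
next
  assume R: ?R
  have "f y > 0 \<longleftrightarrow> f z > 0" if "f \<in> forms_B A" for f
    using that
  proof (cases rule: forms_B_cases)
    case (1 i)
    then have "sgn (y i) = sgn (z i)" using R by blast
    then show ?thesis using 1 by (metis sgn_greater)
  next
    case (2 t i j)
    have "\<bar>y i\<bar> \<noteq> \<bar>y j\<bar>" "\<bar>z i\<bar> \<noteq> \<bar>z j\<bar>" using y z 2 unfolding regular_iff by auto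
    moreover have "\<bar>y i\<bar> < \<bar>y j\<bar> \<longleftrightarrow> \<bar>z i\<bar> < \<bar>z j\<bar>" using R 2 by blast
    moreover have "y i > 0 \<longleftrightarrow> z i > 0" "y j > 0 \<longleftrightarrow> z j > 0" using R 2 by (metis sgn_greater)+
    ultimately show ?thesis using 2 by (auto simp: wall_def abs_if split: if_splits)
  qed
  then show ?L by blast
qed

lemma chamber_regular:
  assumes g: "(\<sigma>, \<epsilon>) \<in> signed_perms n" and y: "y \<in> chamber n (\<sigma>, \<epsilon>)"
  shows "\<forall>f\<in>forms_B {1..n}. f y \<noteq> 0"
  unfolding regular_iff
proof (intro conjI ballI impI)
  have s: "\<sigma> permutes {1..n}" using g by (simp add: signed_perms_def)
  have pre: "\<exists>k\<in>{1..n}. i = \<sigma> k" if "i \<in> {1..n}" for i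
  proof -
    have "i \<in> \<sigma> ` {1..n}" using that permutes_image[OF s] by simp
    then show ?thesis by auto
  qed
  { fix i assume "i \<in> {1..n}"
    then obtain k where k: "k \<in> {1..n}" "i = \<sigma> k" using pre by blast
    then have "\<epsilon> k * y i > 0" using y by (auto simp: chamber_def)
    then show "y i \<noteq> 0" by auto }
  fix i j assume "i \<in> {1..n}" "j \<in> {1..n}" "i \<noteq> j"
  then obtain k l where kl: "k \<in> {1..n}" "i = \<sigma> k" "l \<in> {1..n}" "j = \<sigma> l" "k \<noteq> l" using pre by metis
  have lt: "\<bar>y (\<sigma> j)\<bar> < \<bar>y (\<sigma> i)\<bar>" if "i \<in> {1..n}" "j \<in> {1..n}" "i < j" for i j
    using y that unfolding mem_chamber_iff[OF g] by blast
  show "\<bar>y i\<bar> \<noteq> \<bar>y j\<bar>" using lt[of k l] lt[of l k] kl by (cases "k < l") auto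
qed

text \<open>Chambers are the sign classes of the arrangement. With \<open>y\<close> as reference
  point, both sides compare signs and the order of absolute values, once along
  \<open>\<sigma>\<close> and once over all indices; \<open>\<sigma>\<close> permutes the
  indices.\<close>

lemma chamber_same_signs:
  assumes g: "(\<sigma>, \<epsilon>) \<in> signed_perms n" and y: "y \<in> chamber n (\<sigma>, \<epsilon>)"
    and z: "\<forall>f\<in>forms_B {1..n}. f z \<noteq> 0"
  shows "z \<in> chamber n (\<sigma>, \<epsilon>) \<longleftrightarrow> {f\<in>forms_B {1..n}. f y > 0} = {f\<in>forms_B {1..n}. f z > 0}"
  unfolding same_signs_iff[OF chamber_regular[OF g y] z]
proof -
  have s: "\<sigma> permutes {1..n}" using g by (simp add: signed_perms_def)
  have all: "(\<forall>i\<in>{1..n}. P i) \<longleftrightarrow> (\<forall>i\<in>{1..n}. P (\<sigma> i))" for P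
  proof -
    have "(\<forall>i\<in>\<sigma> ` {1..n}. P i) \<longleftrightarrow> (\<forall>i\<in>{1..n}. P (\<sigma> i))" by blast
    then show ?thesis unfolding permutes_image[OF s] .
  qed
  have y1: "sgn (y (\<sigma> i)) = \<epsilon> i" if "i \<in> {1..n}" for i
    using y that unfolding mem_chamber_iff[OF g] by blast
  have cmp: "\<bar>w (\<sigma> i)\<bar> < \<bar>w (\<sigma> j)\<bar> \<longleftrightarrow> j < i"
    if "\<forall>i\<in>{1..n}. \<forall>j\<in>{1..n}. i < j \<longrightarrow> \<bar>w (\<sigma> j)\<bar> < \<bar>w (\<sigma> i)\<bar>" "i \<in> {1..n}" "j \<in> {1..n}"
    for w :: "nat \<Rightarrow> real" and i j
  proof (rule linorder_cases[of i j])
    assume "i < j"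
    then have "\<bar>w (\<sigma> j)\<bar> < \<bar>w (\<sigma> i)\<bar>" using that by blast
    then show ?thesis using \<open>i < j\<close> by linarith
  next
    assume "j < i"
    then show ?thesis using that by blast
  qed simp
  have y2: "\<forall>i\<in>{1..n}. \<forall>j\<in>{1..n}. i < j \<longrightarrow> \<bar>y (\<sigma> j)\<bar> < \<bar>y (\<sigma> i)\<bar>"
    using y unfolding mem_chamber_iff[OF g] by blast
  have ineq: "(\<forall>i\<in>{1..n}. \<forall>j\<in>{1..n}. i < j \<longrightarrow> \<bar>z (\<sigma> j)\<bar> < \<bar>z (\<sigma> i)\<bar>) \<longleftrightarrow>
    (\<forall>i\<in>{1..n}. \<forall>j\<in>{1..n}. \<bar>y (\<sigma> i)\<bar> < \<bar>y (\<sigma> j)\<bar> \<longleftrightarrow> \<bar>z (\<sigma> i)\<bar> < \<bar>z (\<sigma> j)\<bar>)" (is "?P \<longleftrightarrow> ?Q")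
  proof
    assume ?P
    then show ?Q using cmp[OF \<open>?P\<close>] cmp[OF y2] by simp
  next
    assume ?Q
    then show ?P using y2 by simp
  qed
  have "z \<in> chamber n (\<sigma>, \<epsilon>) \<longleftrightarrow> (\<forall>i\<in>{1..n}. sgn (y (\<sigma> i)) = sgn (z (\<sigma> i))) \<and>
    (\<forall>i\<in>{1..n}. \<forall>j\<in>{1..n}. \<bar>y (\<sigma> i)\<bar> < \<bar>y (\<sigma> j)\<bar> \<longleftrightarrow> \<bar>z (\<sigma> i)\<bar> < \<bar>z (\<sigma> j)\<bar>)"
    unfolding mem_chamber_iff[OF g] ineq using y1 by auto
  also have "\<dots> \<longleftrightarrow> (\<forall>i\<in>{1..n}. sgn (y i) = sgn (z i)) \<and>
    (\<forall>i\<in>{1..n}. \<forall>j\<in>{1..n}. \<bar>y i\<bar> < \<bar>y j\<bar> \<longleftrightarrow> \<bar>z i\<bar> < \<bar>z j\<bar>)"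
    using all[of "\<lambda>i. sgn (y i) = sgn (z i)"]
      all[of "\<lambda>i. \<forall>j\<in>{1..n}. \<bar>y i\<bar> < \<bar>y j\<bar> \<longleftrightarrow> \<bar>z i\<bar> < \<bar>z j\<bar>"]
      all[of "\<lambda>j. \<bar>y (\<sigma> i)\<bar> < \<bar>y j\<bar> \<longleftrightarrow> \<bar>z (\<sigma> i)\<bar> < \<bar>z j\<bar>" for i] by simp
  finally show "z \<in> chamber n (\<sigma>, \<epsilon>) \<longleftrightarrow> (\<forall>i\<in>{1..n}. sgn (y i) = sgn (z i)) \<and>
    (\<forall>i\<in>{1..n}. \<forall>j\<in>{1..n}. \<bar>y i\<bar> < \<bar>y j\<bar> \<longleftrightarrow> \<bar>z i\<bar> < \<bar>z j\<bar>)" .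
qed

lemma chamber_exists:
  assumes y: "\<forall>f\<in>forms_B {1..n}. f y \<noteq> 0"
  shows "\<exists>g\<in>signed_perms n. y \<in> chamber n g"
proof -
  have reg: "\<forall>i\<in>{1..n}. y i \<noteq> 0" "\<forall>i\<in>{1..n}. \<forall>j\<in>{1..n}. i \<noteq> j \<longrightarrow> \<bar>y i\<bar> \<noteq> \<bar>y j\<bar>"
    using y unfolding regular_iff by blast+
  have "inj_on (\<lambda>i. - \<bar>y i\<bar>) {1..n}" using reg(2) by (force simp: inj_on_def)
  then obtain \<sigma> where s: "\<sigma> permutes {1..n}"
    "\<And>i j. i \<in> {1..n} \<Longrightarrow> j \<in> {1..n} \<Longrightarrow> i < j \<Longrightarrow> - \<bar>y (\<sigma> i)\<bar> < - \<bar>y (\<sigma> j)\<bar>"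
    by (rule sorting_permutation) blast
  define \<epsilon> where "\<epsilon> = (\<lambda>i\<in>{1..n}. sgn (y (\<sigma> i)))"
  have "sgn (y (\<sigma> i)) \<in> {-1, 1}" if "i \<in> {1..n}" for i
  proof -
    have "\<sigma> i \<in> {1..n}" using that permutes_in_image[OF s(1)] by simp
    then show ?thesis using reg(1) by (auto simp: sgn_if)
  qed
  then have g: "(\<sigma>, \<epsilon>) \<in> signed_perms n" using s(1) by (auto simp: signed_perms_def \<epsilon>_def)
  have "y \<in> chamber n (\<sigma>, \<epsilon>)"
    unfolding mem_chamber_iff[OF g] using s(2) by (auto simp: \<epsilon>_def)
  with g show ?thesis by blast
qed

text \<open>Each chamber met by \<open>V\<close> is sent to the sign pattern of a chosen point of
  \<open>V\<close> in it. Chambers being sign classes, the choice does not matter and the map is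
  bijective.\<close>

lemma card_chambers_hit:
  "card {g \<in> signed_perms n. \<exists>y\<in>V. y \<in> chamber n g} = card (regions V (forms_B {1..n}))"
proof (rule bij_betw_same_card)
  let ?F = "forms_B {1..n}"
  let ?H = "{g \<in> signed_perms n. \<exists>y\<in>V. y \<in> chamber n g}"
  define w where "w g = (SOME y. y \<in> V \<and> y \<in> chamber n g)" for g
  have w: "w g \<in> V" "w g \<in> chamber n g" if "g \<in> ?H" for g
    using that someI_ex[of "\<lambda>y. y \<in> V \<and> y \<in> chamber n g"] unfolding w_def by auto
  have reg: "\<forall>f\<in>?F. f y \<noteq> 0" if "g \<in> signed_perms n" "y \<in> chamber n g" for g y
    using that chamber_regular by (cases g) blast
  have same: "z \<in> chamber n g \<longleftrightarrow> {f\<in>?F. f y > 0} = {f\<in>?F. f z > 0}"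
    if "g \<in> signed_perms n" "y \<in> chamber n g" "\<forall>f\<in>?F. f z \<noteq> 0" for g y z
    using that chamber_same_signs by (cases g) blast
  show "bij_betw (\<lambda>g. {f\<in>?F. f (w g) > 0}) ?H (regions V ?F)"
    unfolding bij_betw_def
  proof
    show "inj_on (\<lambda>g. {f\<in>?F. f (w g) > 0}) ?H"
    proof (rule inj_onI)
      fix g h assume g: "g \<in> ?H" and h: "h \<in> ?H"
        and eq: "{f\<in>?F. f (w g) > 0} = {f\<in>?F. f (w h) > 0}"
      have gs: "g \<in> signed_perms n" and hs: "h \<in> signed_perms n" using g h by auto
      have "w h \<in> chamber n g" using same[OF gs w(2)[OF g] reg[OF hs w(2)[OF h]]] eq by blast
      then show "g = h" using chamber_unique w(2)[OF h] gs hs by (metis surj_pair)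
    qed
    show "(\<lambda>g. {f\<in>?F. f (w g) > 0}) ` ?H = regions V ?F"
    proof (intro equalityI subsetI)
      fix P assume "P \<in> (\<lambda>g. {f\<in>?F. f (w g) > 0}) ` ?H"
      then obtain g where g: "g \<in> ?H" "P = {f\<in>?F. f (w g) > 0}" by blast
      then have "w g \<in> {y\<in>V. \<forall>f\<in>?F. f y \<noteq> 0}" using w[OF g(1)] reg by blast
      then show "P \<in> regions V ?F" unfolding regions_def g(2) by (rule imageI)
    next
      fix P assume "P \<in> regions V ?F"
      then obtain y where y: "y \<in> V" "\<forall>f\<in>?F. f y \<noteq> 0" "P = {f\<in>?F. f y > 0}"
        by (auto simp: regions_def)
      obtain g where g: "g \<in> signed_perms n" "y \<in> chamber n g" using chamber_exists[OF y(2)] by blast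
      then have gH: "g \<in> ?H" using y(1) by blast
      have "P = {f\<in>?F. f (w g) > 0}"
        using same[OF g(1) w(2)[OF gH] y(2)] g(2) y(3) by simp
      then show "P \<in> (\<lambda>g. {f\<in>?F. f (w g) > 0}) ` ?H" using gH by (rule image_eqI)
    qed
  qed
qed

section \<open>Convex hulls of signed partial sums\<close>

definition signed_sum :: "(nat \<Rightarrow> nat) \<times> (nat \<Rightarrow> real) \<Rightarrow> (nat \<Rightarrow> 'a::real_vector) \<Rightarrow> nat \<Rightarrow> 'a" where
  "signed_sum g x k = (\<Sum>i\<in>{1..k}. snd g i *\<^sub>R x (fst g i))"

lemma down_closed_eq_interval:
  fixes P :: "nat set"
  assumes "P \<subseteq> {1..n}" "\<And>i j. j \<in> P \<Longrightarrow> 1 \<le> i \<Longrightarrow> i \<le> j \<Longrightarrow> i \<in> P"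
  shows "P = {1..card P}"
proof (cases "P = {}")
  case False
  have fin: "finite P" using assms(1) finite_subset by blast
  then have "Max P \<in> P" using False by simp
  have "P = {1..Max P}"
  proof (intro equalityI subsetI)
    fix i assume "i \<in> P"
    then show "i \<in> {1..Max P}" using assms(1) fin by auto
  next
    fix i assume "i \<in> {1..Max P}"
    then show "i \<in> P" using assms(2)[OF \<open>Max P \<in> P\<close>] by simp
  qed
  then show ?thesis by (metis card_atLeastAtMost diff_Suc_1)
qed simp

text \<open>Order the indices by the number of chain members that omit them. An index of
  \<open>B\<close> is omitted by strictly fewer members than an index outside \<open>B\<close>, so
  every member becomes an initial segment.\<close>

lemma chain_permutation:
  fixes \<B> :: "nat set set"
  assumes sub: "\<B> \<subseteq> Pow {1..n}" and chain: "\<forall>B\<in>\<B>. \<forall>C\<in>\<B>. B \<subseteq> C \<or> C \<subseteq> B"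
  obtains \<sigma> where "\<sigma> permutes {1..n}" "\<forall>B\<in>\<B>. B = \<sigma> ` {1..card B}"
proof -
  have fin: "finite \<B>" using sub finite_subset by blast
  define level where "level i = card {B\<in>\<B>. i \<notin> B}" for i
  \<comment> \<open>The summand \<open>i\<close> breaks ties; the factor \<open>n + 1\<close>
    exceeds every index, so the level decides first and \<open>i\<close> is recovered modulo
    \<open>n + 1\<close>.\<close>
  define \<kappa> where "\<kappa> i = level i * (n + 1) + i" for i
  have mod: "\<kappa> i mod (n + 1) = i" if "i \<in> {1..n}" for i
  proof -
    have "\<kappa> i mod (n + 1) = i mod (n + 1)" unfolding \<kappa>_def by (rule mod_mult_self3)
    then show ?thesis using that by simp
  qed
  have "inj_on (\<lambda>i. real (\<kappa> i)) {1..n}"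
  proof (rule inj_onI)
    fix i j assume "i \<in> {1..n}" "j \<in> {1..n}" "real (\<kappa> i) = real (\<kappa> j)"
    then show "i = j" using mod[of i] mod[of j] by simp
  qed
  then obtain \<sigma> where s: "\<sigma> permutes {1..n}"
    "\<And>i j. i \<in> {1..n} \<Longrightarrow> j \<in> {1..n} \<Longrightarrow> i < j \<Longrightarrow> real (\<kappa> (\<sigma> i)) < real (\<kappa> (\<sigma> j))"
    by (rule sorting_permutation) blast
  have down: "l \<in> B" if B: "B \<in> \<B>" "k \<in> B" and l: "l \<in> {1..n}" "\<kappa> l < \<kappa> k" for B k l
  proof (rule ccontr)
    assume "l \<notin> B"
    have sub': "{C\<in>\<B>. k \<notin> C} \<subset> {C\<in>\<B>. l \<notin> C}"
    proof
      show "{C\<in>\<B>. k \<notin> C} \<subseteq> {C\<in>\<B>. l \<notin> C}"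
        using chain B \<open>l \<notin> B\<close> by blast
      have "B \<in> {C\<in>\<B>. l \<notin> C}" "B \<notin> {C\<in>\<B>. k \<notin> C}" using B \<open>l \<notin> B\<close> by auto
      then show "{C\<in>\<B>. k \<notin> C} \<noteq> {C\<in>\<B>. l \<notin> C}" by metis
    qed
    then have "level k < level l" unfolding level_def by (intro psubset_card_mono) (use fin in auto)
    then have "Suc (level k) * (n + 1) \<le> level l * (n + 1)" by (intro mult_le_mono1) simp
    moreover have "k \<in> {1..n}" using B sub by blast
    ultimately have "\<kappa> k \<le> \<kappa> l" by (simp add: \<kappa>_def)
    then show False using l by simp
  qed
  show ?thesis
  proof (rule that[OF s(1)], rule ballI)
    fix B assume B: "B \<in> \<B>"
    define P where "P = {i\<in>{1..n}. \<sigma> i \<in> B}"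
    have im: "\<sigma> ` P = B"
    proof (intro equalityI subsetI)
      fix k assume k: "k \<in> B"
      then have "k \<in> {1..n}" using B sub by blast
      then have "k \<in> \<sigma> ` {1..n}" using permutes_image[OF s(1)] by simp
      then show "k \<in> \<sigma> ` P" using k by (auto simp: P_def)
    qed (auto simp: P_def)
    have "P = {1..card P}"
    proof (rule down_closed_eq_interval)
      show "P \<subseteq> {1..n}" by (auto simp: P_def)
      fix i j assume ij: "j \<in> P" "1 \<le> i" "i \<le> j"
      show "i \<in> P"
      proof (cases "i = j")
        case False
        then have i: "i \<in> {1..n}" "j \<in> {1..n}" "i < j" "\<sigma> j \<in> B" using ij by (auto simp: P_def)
        have "\<sigma> i \<in> B"
        proof (rule down[OF B i(4)])
          show "\<sigma> i \<in> {1..n}" using i(1) permutes_in_image[OF s(1)] by simp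
          show "\<kappa> (\<sigma> i) < \<kappa> (\<sigma> j)" using s(2)[OF i(1-3)] by simp
        qed
        then show ?thesis using i by (simp add: P_def)
      qed (use ij in simp)
    qed
    moreover have "card P = card B"
      using im card_image[OF inj_on_subset[OF permutes_inj[OF s(1)], of P]] by simp
    ultimately show "B = \<sigma> ` {1..card B}" using im by metis
  qed
qed

text \<open>Along the permutation adapted to a chain, the sum over a member \<open>B\<close> is the
  partial sum of length \<open>card B\<close>; distinct members of a chain have distinct
  sizes.\<close>

lemma generic_of_signed_sums:
  fixes x :: "nat \<Rightarrow> 'a::euclidean_space"
  assumes gp: "\<And>g I. g \<in> signed_perms n \<Longrightarrow> I \<subseteq> {1..n} \<Longrightarrow> card I = DIM('a)
      \<Longrightarrow> span (signed_sum g x ` I) = UNIV"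
  shows "generic {0} x {1..n} DIM('a)"
  unfolding generic_def
proof (intro conjI allI impI)
  fix s :: "nat \<Rightarrow> real" and \<B>
  assume s: "\<forall>i\<in>{1..n}. s i \<in> {-1, 1}" and B: "\<B> \<subseteq> Pow {1..n} - {{}}"
    and chain: "\<forall>B\<in>\<B>. \<forall>C\<in>\<B>. B \<subseteq> C \<or> C \<subseteq> B" and card: "card \<B> = DIM('a)"
  have "\<B> \<subseteq> Pow {1..n}" using B by blast
  then obtain \<sigma> where \<sigma>: "\<sigma> permutes {1..n}" "\<forall>B\<in>\<B>. B = \<sigma> ` {1..card B}"
    using chain by (rule chain_permutation)
  define \<epsilon> where "\<epsilon> = (\<lambda>i\<in>{1..n}. s (\<sigma> i))"
  have "s (\<sigma> i) \<in> {-1, 1}" if "i \<in> {1..n}" for i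
    using s that permutes_in_image[OF \<sigma>(1), of i] by blast
  then have g: "(\<sigma>, \<epsilon>) \<in> signed_perms n" using \<sigma>(1) by (auto simp: signed_perms_def \<epsilon>_def)
  have cB: "card B \<in> {1..n}" if "B \<in> \<B>" for B
  proof -
    have "B \<subseteq> {1..n}" "B \<noteq> {}" using that B by auto
    moreover from this have "finite B" using finite_subset by blast
    ultimately show ?thesis using card_mono[of "{1..n}" B] by (simp add: Suc_le_eq card_gt_0_iff)
  qed
  have "inj_on card \<B>"
    by (rule inj_onI) (metis \<sigma>(2))
  then have "card (card ` \<B>) = DIM('a)" using card by (simp add: card_image)
  moreover have "card ` \<B> \<subseteq> {1..n}" using cB by blast
  ultimately have "span (signed_sum (\<sigma>, \<epsilon>) x ` (card ` \<B>)) = UNIV" using gp[OF g] by blast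
  moreover have "signed_sum (\<sigma>, \<epsilon>) x ` (card ` \<B>) = (\<lambda>B. \<Sum>i\<in>B. s i *\<^sub>R x i) ` \<B>"
    unfolding image_image
  proof (rule image_cong[OF refl])
    fix B assume "B \<in> \<B>"
    have "(\<Sum>i\<in>B. s i *\<^sub>R x i) = (\<Sum>i\<in>\<sigma> ` {1..card B}. s i *\<^sub>R x i)"
      using bspec[OF \<sigma>(2) \<open>B \<in> \<B>\<close>] by simp
    also have "\<dots> = (\<Sum>i\<in>{1..card B}. s (\<sigma> i) *\<^sub>R x (\<sigma> i))"
      using permutes_inj[OF \<sigma>(1)] by (subst sum.reindex) (auto intro: inj_on_subset)
    also have "\<dots> = signed_sum (\<sigma>, \<epsilon>) x (card B)"
      unfolding signed_sum_def by (intro sum.cong) (use cB[OF \<open>B \<in> \<B>\<close>] in \<open>auto simp: \<epsilon>_def\<close>)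
    finally show "signed_sum (\<sigma>, \<epsilon>) x (card B) = (\<Sum>i\<in>B. s i *\<^sub>R x i)" by simp
  qed
  ultimately show "span ({0} \<union> (\<lambda>B. \<Sum>i\<in>B. s i *\<^sub>R x i) ` \<B>) = UNIV"
    by (metis span_mono sup_ge2 top.extremum_uniqueI)
qed (auto simp: subspace_0)

text \<open>The boundary term makes the induction on \<open>n\<close> work; in the applications
  \<open>z (Suc n) = 0\<close>.\<close>

lemma summation_by_parts:
  fixes w :: "nat \<Rightarrow> 'a::real_vector" and z :: "nat \<Rightarrow> real"
  shows "(\<Sum>k\<in>{1..n}. (z k - z (Suc k)) *\<^sub>R (\<Sum>i\<in>{1..k}. w i))
       = (\<Sum>i\<in>{1..n}. z i *\<^sub>R w i) - z (Suc n) *\<^sub>R (\<Sum>i\<in>{1..n}. w i)"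
  by (induction n) (simp_all add: algebra_simps)

text \<open>The weights are indexed by \<open>K\<close> and not by the image, because
  \<open>v\<close> may repeat values.\<close>

lemma convex_hull_image_weights:
  fixes v :: "'k \<Rightarrow> 'a::real_vector"
  assumes K: "finite K" and "p \<in> convex hull (v ` K)"
  obtains u where "\<And>k. k \<in> K \<Longrightarrow> u k \<ge> (0::real)" "sum u K = 1" "(\<Sum>k\<in>K. u k *\<^sub>R v k) = p"
proof -
  let ?S = "{p. \<exists>u. (\<forall>k\<in>K. u k \<ge> (0::real)) \<and> sum u K = 1 \<and> (\<Sum>k\<in>K. u k *\<^sub>R v k) = p}"
  have "convex hull (v ` K) \<subseteq> ?S"
  proof (rule hull_minimal)
    show "v ` K \<subseteq> ?S"
    proof (rule image_subsetI)
      fix l assume l: "l \<in> K"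
      have "(\<Sum>k\<in>K. (if k = l then 1 else 0) *\<^sub>R v k) = (\<Sum>k\<in>K. if k = l then v k else 0)"
        by (intro sum.cong) auto
      then show "v l \<in> ?S"
        using l K by (intro CollectI exI[of _ "\<lambda>k. if k = l then 1 else 0"]) simp
    qed
    show "convex ?S"
    proof (rule convexI)
      fix p q and a b :: real
      assume "p \<in> ?S" "q \<in> ?S" and ab: "0 \<le> a" "0 \<le> b" "a + b = 1"
      then obtain u w where u: "\<forall>k\<in>K. u k \<ge> 0" "sum u K = 1" "(\<Sum>k\<in>K. u k *\<^sub>R v k) = p"
        and w: "\<forall>k\<in>K. w k \<ge> 0" "sum w K = 1" "(\<Sum>k\<in>K. w k *\<^sub>R v k) = q" by auto
      have "(\<Sum>k\<in>K. (a * u k + b * w k) *\<^sub>R v k) = a *\<^sub>R p + b *\<^sub>R q"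
        unfolding u(3)[symmetric] w(3)[symmetric]
        by (simp add: scaleR_add_left sum.distrib scaleR_sum_right)
      moreover have "(\<Sum>k\<in>K. a * u k + b * w k) = 1"
        using u(2) w(2) ab(3) by (simp add: sum.distrib sum_distrib_left[symmetric])
      ultimately show "a *\<^sub>R p + b *\<^sub>R q \<in> ?S"
        using u(1) w(1) ab by (intro CollectI exI[of _ "\<lambda>k. a * u k + b * w k"]) simp
    qed
  qed
  then show ?thesis using assms(2) that by blast
qed

text \<open>In general position a vanishing convex combination has at least \<open>DIM('a)\<close> positive weights;
  the vectors carrying them span, so that all weights can be perturbed to positive ones.\<close>

lemma positive_combination:
  fixes v :: "nat \<Rightarrow> 'a::euclidean_space"
  assumes n: "DIM('a) \<le> n"
    and gp: "\<And>I. I \<subseteq> {1..n} \<Longrightarrow> card I = DIM('a) \<Longrightarrow> span (v ` I) = UNIV"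
    and hull: "0 \<in> convex hull (v ` {1..n})"
  obtains u where "\<And>k. k \<in> {1..n} \<Longrightarrow> u k > (0::real)" "(\<Sum>k\<in>{1..n}. u k *\<^sub>R v k) = 0"
proof -
  obtain u where u: "\<And>k. k \<in> {1..n} \<Longrightarrow> u k \<ge> (0::real)" "sum u {1..n} = 1"
    "(\<Sum>k\<in>{1..n}. u k *\<^sub>R v k) = 0"
    using convex_hull_image_weights[OF _ hull] by blast
  define I where "I = {k\<in>{1..n}. u k > 0}"
  have "DIM('a) \<le> card I"
  proof (rule ccontr)
    assume "\<not> ?thesis"
    moreover have "I \<subseteq> {1..n}" by (auto simp: I_def)
    \<comment> \<open>With too few positive weights, their indices are padded to
      \<open>DIM('a)\<close> many. General position makes those vectors independent, so all weights
      vanish, although they add up to 1.\<close>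
    ultimately obtain J where J: "I \<subseteq> J" "J \<subseteq> {1..n}" "card J = DIM('a)"
      using exists_subset_between[of I "DIM('a)" "{1..n}"] n by auto
    have fJ: "finite J" using J(2) finite_subset by blast
    have out: "u k = 0" if "k \<in> {1..n} - J" for k using u(1)[of k] that J(1) by (force simp: I_def)
    have "(\<Sum>k\<in>J. u k *\<^sub>R v k) = (\<Sum>k\<in>{1..n}. u k *\<^sub>R v k)"
      by (rule sum.mono_neutral_left) (use J(2) out in auto)
    then have "(\<Sum>k\<in>J. u k *\<^sub>R v k) \<in> {0}" using u(3) by simp
    moreover have "span ({0} \<union> v ` J) = UNIV" using gp[OF J(2,3)] by simp
    ultimately have "\<forall>k\<in>J. u k = 0"
      using independent_modulo[OF fJ, of "{0}" v u] J(3) by (simp add: subspace_0)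
    then have "sum u {1..n} = 0" using out by (intro sum.neutral) auto
    then show False using u(2) by simp
  qed
  then obtain J where J: "J \<subseteq> I" "card J = DIM('a)" "finite J" using obtain_subset_with_card_n by blast
  have Jn: "J \<subseteq> {1..n}" using J(1) by (auto simp: I_def)
  have "span ({0} \<union> v ` J) = UNIV" using gp[OF Jn J(2)] by simp
  \<comment> \<open>Every weight is to grow by a small \<open>\<delta>\<close>, which adds
    \<open>\<delta>\<close> times the sum of all \<open>v k\<close>. The coefficients
    \<open>c\<close> cancel this on \<open>J\<close>, where the weights are positive and tolerate a
    small change of either sign.\<close>
  from span_modulo[OF _ J(3) this, of "- (\<Sum>k\<in>{1..n}. v k)"]
  obtain c where c: "(\<Sum>k\<in>J. c k *\<^sub>R v k) = - (\<Sum>k\<in>{1..n}. v k)" by (auto simp: subspace_0)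
  have "eventually (\<lambda>\<delta>. u k + \<delta> * (1 + c k) > 0) (at_right 0)" if "k \<in> J" for k
  proof -
    have "((\<lambda>\<delta>. u k + \<delta> * (1 + c k)) \<longlongrightarrow> u k + 0 * (1 + c k)) (at_right 0)"
      by (intro tendsto_intros)
    moreover have "u k > 0" using that J(1) by (auto simp: I_def)
    ultimately show ?thesis using order_tendstoD(1)[of _ "u k" _ 0] by simp
  qed
  then have "eventually (\<lambda>\<delta>. \<forall>k\<in>J. u k + \<delta> * (1 + c k) > 0) (at_right 0)"
    using J(3) by (simp add: eventually_ball_finite)
  then have "eventually (\<lambda>\<delta>. (\<forall>k\<in>J. u k + \<delta> * (1 + c k) > 0) \<and> \<delta> > 0) (at_right 0)"
    using eventually_at_right_less eventually_conj by blast
  then obtain \<delta> where \<delta>: "\<delta> > 0" "\<And>k. k \<in> J \<Longrightarrow> u k + \<delta> * (1 + c k) > 0"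
    using eventually_happens[of _ "at_right (0::real)"] by force
  define w where "w k = u k + \<delta> * (1 + (if k \<in> J then c k else 0))" for k
  have "w k > 0" if "k \<in> {1..n}" for k
    using \<delta> u(1)[OF that] by (auto simp: w_def add_nonneg_pos)
  moreover have "(\<Sum>k\<in>{1..n}. w k *\<^sub>R v k) = 0"
  proof -
    have "(\<Sum>k\<in>{1..n}. (if k \<in> J then c k else 0) *\<^sub>R v k) = (\<Sum>k\<in>J. c k *\<^sub>R v k)"
      by (rule sum.mono_neutral_cong_right) (use Jn in auto)
    moreover have "(\<Sum>k\<in>{1..n}. w k *\<^sub>R v k) = (\<Sum>k\<in>{1..n}. u k *\<^sub>R v k)
        + \<delta> *\<^sub>R ((\<Sum>k\<in>{1..n}. v k) + (\<Sum>k\<in>{1..n}. (if k \<in> J then c k else 0) *\<^sub>R v k))"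
      unfolding w_def scaleR_add_left sum.distrib scaleR_add_right scaleR_sum_right distrib_left by simp
    ultimately show ?thesis using u(3) c by simp
  qed
  ultimately show ?thesis using that by blast
qed

lemma sum_signed_reindex:
  fixes x :: "nat \<Rightarrow> 'a::real_vector"
  assumes g: "(\<sigma>, \<epsilon>) \<in> signed_perms n"
  shows "(\<Sum>k\<in>{1..n}. y k *\<^sub>R x k) = (\<Sum>i\<in>{1..n}. (\<epsilon> i * y (\<sigma> i)) *\<^sub>R (\<epsilon> i *\<^sub>R x (\<sigma> i)))"
proof -
  have e: "\<epsilon> i \<in> {-1, 1}" if "i \<in> {1..n}" for i
    using g that by (auto simp: signed_perms_def)
  have sq: "\<epsilon> i * y (\<sigma> i) * \<epsilon> i = y (\<sigma> i)" if "i \<in> {1..n}" for i using e[OF that] by auto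
  have "(\<Sum>k\<in>{1..n}. y k *\<^sub>R x k) = (\<Sum>i\<in>{1..n}. y (\<sigma> i) *\<^sub>R x (\<sigma> i))"
    using g by (intro sum.permute[unfolded comp_def]) (simp add: signed_perms_def)
  also have "\<dots> = (\<Sum>i\<in>{1..n}. (\<epsilon> i * y (\<sigma> i)) *\<^sub>R (\<epsilon> i *\<^sub>R x (\<sigma> i)))"
    by (intro sum.cong) (simp_all add: sq)
  finally show ?thesis .
qed

text \<open>Positive weights \<open>u k\<close> on the partial sums correspond to a positive
  decreasing sequence \<open>z\<close> on the steps by \<open>u k = z k - z (Suc k)\<close>. Since
  chambers are open, the weights of the convex combination are first made strictly positive.\<close>

lemma zero_in_hull_iff_chamber:
  fixes x :: "nat \<Rightarrow> 'a::euclidean_space"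
  assumes n: "DIM('a) \<le> n" and g: "g \<in> signed_perms n"
    and gp: "\<And>I. I \<subseteq> {1..n} \<Longrightarrow> card I = DIM('a) \<Longrightarrow> span (signed_sum g x ` I) = UNIV"
  shows "0 \<in> convex hull (signed_sum g x ` {1..n}) \<longleftrightarrow> (\<exists>y\<in>relations {0} x {1..n}. y \<in> chamber n g)"
proof
  obtain \<sigma> \<epsilon> where ge: "g = (\<sigma>, \<epsilon>)" by force
  have s: "\<sigma> permutes {1..n}" and e: "\<And>i. i \<in> {1..n} \<Longrightarrow> \<epsilon> i \<in> {-1, 1}"
    using g by (auto simp: signed_perms_def ge)
  have n0: "0 < n" using n DIM_positive[where 'a='a] by linarith
  {
    assume "0 \<in> convex hull (signed_sum g x ` {1..n})"
    then obtain u where u: "\<And>k. k \<in> {1..n} \<Longrightarrow> u k > (0::real)" "(\<Sum>k\<in>{1..n}. u k *\<^sub>R signed_sum g x k) = 0"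
      using positive_combination[OF n gp] by blast
    define z where "z i = (\<Sum>k\<in>{i..n}. u k)" for i
    \<comment> \<open>The inverse permutation places the tail sums \<open>z\<close> so that
      \<open>\<epsilon> i * y (\<sigma> i) = z i\<close>, as the chamber requires.\<close>
    define y where "y k = \<epsilon> (inv \<sigma> k) * z (inv \<sigma> k)" for k
    have z_Suc: "z k = u k + z (Suc k)" if "k \<in> {1..n}" for k
      unfolding z_def using that by (simp add: sum.atLeast_Suc_atMost)
    have z_pos: "z k > 0" if "k \<in> {1..n}" for k
      unfolding z_def using that u(1) by (intro sum_pos) auto
    have z_less: "z j < z i" if "i \<in> {1..n}" "j \<in> {1..n}" "i < j" for i j
      unfolding z_def using that u(1)
      by (intro sum_strict_mono2[of _ _ i]) (auto intro: less_imp_le)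
    have ey: "\<epsilon> i * y (\<sigma> i) = z i" if "i \<in> {1..n}" for i
    proof -
      have "inv \<sigma> (\<sigma> i) = i" using permutes_inverses(2)[OF s] .
      then show ?thesis using e[OF that] by (auto simp: y_def)
    qed
    have "(\<Sum>k\<in>{1..n}. y k *\<^sub>R x k) = (\<Sum>i\<in>{1..n}. z i *\<^sub>R (\<epsilon> i *\<^sub>R x (\<sigma> i)))"
      using sum_signed_reindex[OF g[unfolded ge], of y x] ey by simp
    also have "\<dots> = (\<Sum>k\<in>{1..n}. (z k - z (Suc k)) *\<^sub>R signed_sum g x k)"
      using summation_by_parts[of z "\<lambda>i. \<epsilon> i *\<^sub>R x (\<sigma> i)" n] by (simp add: signed_sum_def ge z_def)
    also have "\<dots> = (\<Sum>k\<in>{1..n}. u k *\<^sub>R signed_sum g x k)"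
      by (intro sum.cong) (simp_all add: z_Suc)
    finally have "y \<in> relations {0} x {1..n}" using u(2) by (simp add: relations_def)
    moreover have "y \<in> chamber n g" using ey z_pos z_less by (simp add: chamber_def ge)
    ultimately show "\<exists>y\<in>relations {0} x {1..n}. y \<in> chamber n g" by blast
  }
  assume "\<exists>y\<in>relations {0} x {1..n}. y \<in> chamber n g"
  then obtain y where y: "(\<Sum>k\<in>{1..n}. y k *\<^sub>R x k) = 0" "y \<in> chamber n (\<sigma>, \<epsilon>)"
    by (auto simp: relations_def ge)
  \<comment> \<open>The default 0 removes the boundary term at \<open>n + 1\<close> and makes the
    last weight \<open>u n = z n\<close>, which is positive in the chamber.\<close>
  define z where "z i = (if i \<in> {1..n} then \<epsilon> i * y (\<sigma> i) else 0)" for i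
  define u where "u k = z k - z (Suc k)" for k
  have u: "u k > 0" if "k \<in> {1..n}" for k
    using y(2) that by (auto simp: u_def z_def chamber_def)
  have "(\<Sum>k\<in>{1..n}. u k *\<^sub>R signed_sum g x k) = (\<Sum>i\<in>{1..n}. z i *\<^sub>R (\<epsilon> i *\<^sub>R x (\<sigma> i)))"
    using summation_by_parts[of z "\<lambda>i. \<epsilon> i *\<^sub>R x (\<sigma> i)" n] by (simp add: signed_sum_def ge u_def z_def)
  also have "\<dots> = 0"
    using sum_signed_reindex[OF g[unfolded ge], of y x] y(1) by (simp add: z_def)
  finally have zero: "(\<Sum>k\<in>{1..n}. u k *\<^sub>R signed_sum g x k) = 0" .
  define t where "t = sum u {1..n}"
  have t: "t > 0" unfolding t_def using u n0 by (intro sum_pos) auto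
  have "(\<Sum>k\<in>{1..n}. (u k / t) *\<^sub>R signed_sum g x k) \<in> convex hull (signed_sum g x ` {1..n})"
  proof (rule convex_sum)
    show "(\<Sum>k\<in>{1..n}. u k / t) = 1" using t by (simp add: t_def sum_divide_distrib[symmetric])
  qed (use u t in \<open>auto simp: less_imp_le intro: hull_inc\<close>)
  moreover have "(\<Sum>k\<in>{1..n}. (u k / t) *\<^sub>R signed_sum g x k) = inverse t *\<^sub>R (\<Sum>k\<in>{1..n}. u k *\<^sub>R signed_sum g x k)"
    by (simp add: scaleR_sum_right divide_inverse mult.commute)
  ultimately show "0 \<in> convex hull (signed_sum g x ` {1..n})" using zero by simp
qed

text \<open>The deterministic core: for steps in general position the number of signed permutations
  whose walk surrounds 0 depends only on \<open>n\<close> and the dimension.\<close>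

lemma card_signed_perms_hull:
  fixes x :: "nat \<Rightarrow> 'a::euclidean_space"
  assumes n: "DIM('a) \<le> n"
    and gp: "\<And>g I. g \<in> signed_perms n \<Longrightarrow> I \<subseteq> {1..n} \<Longrightarrow> card I = DIM('a)
      \<Longrightarrow> span (signed_sum g x ` I) = UNIV"
  shows "card {g \<in> signed_perms n. 0 \<in> convex hull (signed_sum g x ` {1..n})} = 2 * B_tail n (DIM('a) + 1)"
proof -
  have "{g \<in> signed_perms n. 0 \<in> convex hull (signed_sum g x ` {1..n})}
      = {g \<in> signed_perms n. \<exists>y\<in>relations {0} x {1..n}. y \<in> chamber n g}"
    using zero_in_hull_iff_chamber[OF n _ gp] by blast
  also have "card \<dots> = card (regions (relations {0} x {1..n}) (forms_B {1..n}))"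
    by (rule card_chambers_hit)
  also have "\<dots> = 2 * B_tail n (DIM('a) + 1)"
  proof -
    have "n > 0" using n DIM_positive[where 'a='a] by linarith
    then show ?thesis
      using card_regions_generic[of "{1..n}" "DIM('a)" "{0}" x] generic_of_signed_sums[OF gp] n by simp
  qed
  finally show ?thesis .
qed

section \<open>Random walks\<close>

text \<open>The directions strictly positive on finitely many vectors form an open set, so a
  separating direction can be moved into a dense set. With a countable \<open>D\<close> this gives
  measurability of the hull event.\<close>

lemma zero_not_in_hull_iff_dense:
  fixes f :: "'k \<Rightarrow> 'a::euclidean_space"
  assumes K: "finite K" and D: "\<And>X. open X \<Longrightarrow> X \<noteq> {} \<Longrightarrow> \<exists>d\<in>D. d \<in> X"
  shows "0 \<notin> convex hull (f ` K) \<longleftrightarrow> (\<exists>u\<in>D. \<forall>k\<in>K. u \<bullet> f k > 0)"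
proof
  assume "0 \<notin> convex hull (f ` K)"
  moreover have "closed (convex hull (f ` K))"
    using K by (intro compact_imp_closed finite_imp_compact_convex_hull) simp
  ultimately obtain a b where "0 < b" "\<forall>x\<in>convex hull (f ` K). a \<bullet> x > b"
    using separating_hyperplane_closed_0[OF convex_convex_hull] by blast
  then have "\<forall>k\<in>K. a \<bullet> f k > 0" by (meson hull_inc imageI less_trans)
  then have "a \<in> (\<Inter>k\<in>K. {u. f k \<bullet> u > 0})" by (simp add: inner_commute)
  moreover have "open (\<Inter>k\<in>K. {u. f k \<bullet> u > 0})"
    using K by (intro open_INT) (auto simp: open_halfspace_gt)
  ultimately obtain u where "u \<in> D" "u \<in> (\<Inter>k\<in>K. {u. f k \<bullet> u > 0})" using D by blast
  then show "\<exists>u\<in>D. \<forall>k\<in>K. u \<bullet> f k > 0" by (auto simp: inner_commute)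
next
  assume "\<exists>u\<in>D. \<forall>k\<in>K. u \<bullet> f k > 0"
  then obtain u where "\<forall>k\<in>K. u \<bullet> f k > 0" by blast
  then have "convex hull (f ` K) \<subseteq> {x. u \<bullet> x > 0}"
    by (intro hull_minimal) (auto simp: convex_halfspace_gt)
  then show "0 \<notin> convex hull (f ` K)" by auto
qed

section \<open>Measurability of the hull event and of general position\<close>

lemma measurable_partial_sums:
  fixes k n :: nat
  assumes "k \<le> n"
  shows "(\<lambda>v. \<Sum>i\<in>{1..k}. v i :: 'a::euclidean_space) \<in> borel_measurable (PiM {1..n} (\<lambda>_. borel))"
  using assms by (intro borel_measurable_sum measurable_component_singleton) auto

lemma sets_zero_in_hull:
  "{v \<in> space (PiM {1..n} (\<lambda>_. borel)). 0 \<in> convex hull ((\<lambda>k. \<Sum>i\<in>{1..k}. v i) ` {1..n})}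
     \<in> sets (PiM {1..n} (\<lambda>_. borel) :: (nat \<Rightarrow> 'a::euclidean_space) measure)"
proof -
  let ?N = "PiM {1..n} (\<lambda>_. borel) :: (nat \<Rightarrow> 'a) measure"
  obtain D :: "'a set" where D: "countable D" "\<And>X. open X \<Longrightarrow> X \<noteq> {} \<Longrightarrow> \<exists>d\<in>D. d \<in> X"
    using countable_dense_exists by metis
  have "{v \<in> space ?N. u \<bullet> (\<Sum>i\<in>{1..k}. v i) > 0} \<in> sets ?N" if "k \<in> {1..n}" for u k
  proof -
    have "(\<lambda>v. u \<bullet> (\<Sum>i\<in>{1..k}. v i)) \<in> borel_measurable ?N"
      using that by (intro borel_measurable_inner measurable_partial_sums) auto
    then show ?thesis by (simp add: borel_measurable_iff_greater)
  qed
  then have "{v \<in> space ?N. \<exists>u\<in>D. \<forall>k\<in>{1..n}. u \<bullet> (\<Sum>i\<in>{1..k}. v i) > 0} \<in> sets ?N"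
    by (intro sets.sets_Collect_countable_Ex'[OF _ D(1)] sets.sets_Collect_finite_All) auto
  then have "{v \<in> space ?N. \<not> (\<exists>u\<in>D. \<forall>k\<in>{1..n}. u \<bullet> (\<Sum>i\<in>{1..k}. v i) > 0)} \<in> sets ?N"
    by (rule sets.sets_Collect_neg)
  moreover have "0 \<in> convex hull ((\<lambda>k. \<Sum>i\<in>{1..k}. v i) ` {1..n})
      \<longleftrightarrow> \<not> (\<exists>u\<in>D. \<forall>k\<in>{1..n}. u \<bullet> (\<Sum>i\<in>{1..k}. v i) > 0)" for v :: "nat \<Rightarrow> 'a"
    using zero_not_in_hull_iff_dense[OF finite_atLeastAtMost D(2), of "\<lambda>k. \<Sum>i\<in>{1..k}. v i" 1 n] by blast
  ultimately show ?thesis by simp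
qed

text \<open>After numbering \<open>I\<close> by the coordinate type, spanning means a nonzero
  determinant of the square matrix whose rows are these partial sums, and the determinant is a
  polynomial in the entries.\<close>

lemma sets_partial_sums_span:
  assumes I: "I \<subseteq> {1..n}" "card I = CARD('d)"
  shows "{v \<in> space (PiM {1..n} (\<lambda>_. borel)). span ((\<lambda>k. \<Sum>i\<in>{1..k}. v i) ` I) = UNIV}
     \<in> sets (PiM {1..n} (\<lambda>_. borel) :: (nat \<Rightarrow> real ^ 'd) measure)"
proof -
  let ?N = "PiM {1..n} (\<lambda>_. borel) :: (nat \<Rightarrow> real ^ 'd) measure"
  have "finite I" using I(1) finite_subset by blast
  then obtain \<beta> where \<beta>: "bij_betw \<beta> (UNIV :: 'd set) I"
    using I(2) finite_same_card_bij[of "UNIV :: 'd set" I] by auto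
  have \<beta>n: "\<beta> i \<le> n" for i
  proof -
    have "\<beta> i \<in> {1..n}" using bij_betw_apply[OF \<beta>, of i] I(1) by blast
    then show ?thesis by simp
  qed
  define A where "A v = (\<chi> i. \<Sum>l\<in>{1..\<beta> i}. v l)" for v :: "nat \<Rightarrow> real ^ 'd"
  have "(\<lambda>v. A v $ i $ j) \<in> borel_measurable ?N" for i j
  proof -
    have "(\<lambda>v. (\<Sum>l\<in>{1..\<beta> i}. v l) \<bullet> axis j 1) \<in> borel_measurable ?N"
      by (intro borel_measurable_inner measurable_partial_sums \<beta>n) auto
    then show ?thesis by (simp add: A_def inner_axis)
  qed
  then have "(\<lambda>v. det (A v)) \<in> borel_measurable ?N"
    unfolding det_def by (intro borel_measurable_sum borel_measurable_times borel_measurable_prod) auto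
  then have "{v \<in> space ?N. det (A v) \<noteq> 0} \<in> sets ?N"
    by (intro sets.sets_Collect_neg) (auto simp: borel_measurable_eq)
  moreover have "det (A v) \<noteq> 0 \<longleftrightarrow> span ((\<lambda>k. \<Sum>i\<in>{1..k}. v i) ` I) = UNIV" for v
  proof -
    have "rows (A v) = (\<lambda>k. \<Sum>i\<in>{1..k}. v i) ` \<beta> ` UNIV"
      by (auto simp: rows_def row_def A_def vec_eq_iff image_iff)
    also have "\<beta> ` UNIV = I" using \<beta> by (simp add: bij_betw_def)
    finally have "rows (A v) = (\<lambda>k. \<Sum>i\<in>{1..k}. v i) ` I" .
    then show ?thesis
      using matrix_left_invertible_span_rows[of "A v"] invertible_det_nz[of "A v"]
        invertible_left_inverse[of "A v"] by simp
  qed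
  ultimately show ?thesis by simp
qed

lemma span_independent_image:
  fixes w :: "'k \<Rightarrow> 'a::euclidean_space"
  assumes "card I = DIM('a)" "inj_on w I" "independent (w ` I)"
  shows "span (w ` I) = UNIV"
proof -
  have "card (w ` I) = dim (UNIV :: 'a set)" using assms by (simp add: card_image)
  then have "UNIV \<subseteq> span (w ` I)" using assms(3) by (intro card_ge_dim_independent) auto
  then show ?thesis by blast
qed

theorem theorem2p3:
  fixes M :: "'w measure" and \<xi> :: "nat \<Rightarrow> 'w \<Rightarrow> real ^ 'd" and n :: nat
  assumes "prob_space M"
    and "CARD('d) \<le> n"
    and rv: "\<And>i. i \<in> {1..n} \<Longrightarrow> \<xi> i \<in> borel_measurable M"
    and sym_exch: "\<And>\<sigma> \<epsilon>. \<sigma> permutes {1..n} \<Longrightarrow> (\<forall>i\<in>{1..n}. \<epsilon> i \<in> {-1, 1::real}) \<Longrightarrow>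
        distr M (PiM {1..n} (\<lambda>_. borel)) (\<lambda>\<omega>. \<lambda>i\<in>{1..n}. \<xi> i \<omega>)
      = distr M (PiM {1..n} (\<lambda>_. borel)) (\<lambda>\<omega>. \<lambda>i\<in>{1..n}. \<epsilon> i *\<^sub>R \<xi> (\<sigma> i) \<omega>)"
    and lin_indep: "\<And>I. I \<subseteq> {1..n} \<Longrightarrow> card I = CARD('d) \<Longrightarrow>
        AE \<omega> in M. inj_on (\<lambda>k. partial_sum \<xi> k \<omega>) I
                   \<and> independent ((\<lambda>k. partial_sum \<xi> k \<omega>) ` I)"
  shows "measure M {\<omega> \<in> space M. 0 \<in> convex hull ((\<lambda>k. partial_sum \<xi> k \<omega>) ` {1..n})}
       = 2 / (2 ^ n * fact n) * (\<Sum>j\<le>n. real (B_coeff n (CARD('d) + 1 + 2 * j)))"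
proof -
  interpret prob_space M by fact
  let ?N = "PiM {1..n} (\<lambda>_. borel) :: (nat \<Rightarrow> real ^ 'd) measure"
  define psum where "psum v k = (\<Sum>i\<in>{1..k}. v i)" for v :: "nat \<Rightarrow> real ^ 'd" and k
  define X where "X = (\<lambda>\<omega>. \<lambda>i\<in>{1..n}. \<xi> i \<omega>)"
  \<comment> \<open>\<open>Y g\<close> is the vector of steps after applying the signed permutation
    \<open>g\<close>, \<open>S g\<close> its walk and \<open>A g\<close> the event that this walk
    has 0 in its hull.\<close>
  define Y where "Y g = (\<lambda>\<omega>. \<lambda>i\<in>{1..n}. snd g i *\<^sub>R \<xi> (fst g i) \<omega>)" for g
  define S where "S g \<omega> = signed_sum g (\<lambda>i. \<xi> i \<omega>)" for g \<omega>
  define A where "A g = {\<omega> \<in> space M. 0 \<in> convex hull (S g \<omega> ` {1..n})}" for g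
  have g: "fst g permutes {1..n}" "\<forall>i\<in>{1..n}. snd g i \<in> {-1, 1}" if "g \<in> signed_perms n" for g
    using that by (auto simp: signed_perms_def)
  have X: "X \<in> measurable M ?N" unfolding X_def by (rule measurable_restrict) (rule rv)
  have Y: "Y g \<in> measurable M ?N" if "g \<in> signed_perms n" for g
    unfolding Y_def
  proof (rule measurable_restrict)
    fix i assume "i \<in> {1..n}"
    then have "fst g i \<in> {1..n}" using permutes_in_image[OF g(1)[OF that]] by simp
    then show "(\<lambda>\<omega>. snd g i *\<^sub>R \<xi> (fst g i) \<omega>) \<in> borel_measurable M"
      using rv by (intro borel_measurable_scaleR) auto
  qed
  have distr: "distr M ?N (Y g) = distr M ?N X" if "g \<in> signed_perms n" for g
    unfolding X_def Y_def by (rule sym_exch[symmetric]) (use g[OF that] in auto)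
  have psum_X: "psum (X \<omega>) k = partial_sum \<xi> k \<omega>" if "k \<in> {1..n}" for \<omega> k
    unfolding psum_def X_def partial_sum_def using that by (intro sum.cong) auto
  have psum_Y: "psum (Y g \<omega>) k = S g \<omega> k" if "k \<in> {1..n}" for g \<omega> k
    unfolding psum_def Y_def S_def signed_sum_def using that by (intro sum.cong) auto

  let ?E = "{v \<in> space ?N. 0 \<in> convex hull (psum v ` {1..n})}"
  have E: "?E \<in> sets ?N" unfolding psum_def by (rule sets_zero_in_hull)
  have "psum (X \<omega>) ` {1..n} = (\<lambda>k. partial_sum \<xi> k \<omega>) ` {1..n}" for \<omega>
    using psum_X by (intro image_cong) auto
  then have pre_X: "X -` ?E \<inter> space M
      = {\<omega> \<in> space M. 0 \<in> convex hull ((\<lambda>k. partial_sum \<xi> k \<omega>) ` {1..n})}"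
    using measurable_space[OF X] by auto
  have "psum (Y g \<omega>) ` {1..n} = S g \<omega> ` {1..n}" for g \<omega>
    using psum_Y by (intro image_cong) auto
  then have pre_Y: "Y g -` ?E \<inter> space M = A g" if "g \<in> signed_perms n" for g
    using measurable_space[OF Y[OF that]] by (auto simp: A_def)
  have A: "A g \<in> sets M" if "g \<in> signed_perms n" for g
    using measurable_sets[OF Y[OF that] E] pre_Y[OF that] by simp
  have prob_A: "prob (A g)
      = prob {\<omega> \<in> space M. 0 \<in> convex hull ((\<lambda>k. partial_sum \<xi> k \<omega>) ` {1..n})}"
    if "g \<in> signed_perms n" for g
    using measure_distr[OF X E] measure_distr[OF Y[OF that] E]
    unfolding pre_X pre_Y[OF that] distr[OF that] by simp

  \<comment> \<open>General position is assumed for the original walk only. It is a measurable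
    property of the vector of steps, whose law \<open>g\<close> leaves invariant, so it holds almost
    surely for each transformed walk.\<close>
  have span_g: "AE \<omega> in M. span (S g \<omega> ` I) = UNIV"
    if gs: "g \<in> signed_perms n" and I: "I \<subseteq> {1..n}" "card I = CARD('d)" for g I
  proof -
    have Q: "{v \<in> space ?N. span (psum v ` I) = UNIV} \<in> sets ?N"
      unfolding psum_def by (rule sets_partial_sums_span[OF I])
    have "AE \<omega> in M. span (psum (X \<omega>) ` I) = UNIV"
      using lin_indep[OF I]
    proof eventually_elim
      case (elim \<omega>)
      have "psum (X \<omega>) ` I = (\<lambda>k. partial_sum \<xi> k \<omega>) ` I"
        using I(1) by (intro image_cong refl psum_X) blast
      then show ?case using span_independent_image[of I "\<lambda>k. partial_sum \<xi> k \<omega>"] elim I(2) by simp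
    qed
    then have "AE v in distr M ?N (Y g). span (psum v ` I) = UNIV"
      unfolding distr[OF gs] AE_distr_iff[OF X Q] .
    then have "AE \<omega> in M. span (psum (Y g \<omega>) ` I) = UNIV"
      unfolding AE_distr_iff[OF Y[OF gs] Q] .
    moreover have "psum (Y g \<omega>) ` I = S g \<omega> ` I" for \<omega>
      using I(1) by (intro image_cong refl psum_Y) blast
    ultimately show ?thesis by simp
  qed
  \<comment> \<open>There are finitely many pairs of a signed permutation and an index set, so one
    null set serves for all of them, as the pointwise count needs.\<close>
  have "AE \<omega> in M. \<forall>p\<in>signed_perms n \<times> {I. I \<subseteq> {1..n} \<and> card I = CARD('d)}.
      span (S (fst p) \<omega> ` snd p) = UNIV"
  proof (rule AE_finite_allI)
    have "finite {I. I \<subseteq> {1..n} \<and> card I = CARD('d)}"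
      by (rule finite_subset[of _ "Pow {1..n}"]) auto
    then show "finite (signed_perms n \<times> {I. I \<subseteq> {1..n} \<and> card I = CARD('d)})"
      using finite_signed_perms by blast
  qed (use span_g in auto)
  then have count: "AE \<omega> in M. (\<Sum>g\<in>signed_perms n. indicator (A g) \<omega>) = real (2 * B_tail n (CARD('d) + 1))"
    using AE_space
  proof eventually_elim
    case (elim \<omega>)
    have "(\<Sum>g\<in>signed_perms n. indicator (A g) \<omega>)
        = (\<Sum>g\<in>signed_perms n. if 0 \<in> convex hull (S g \<omega> ` {1..n}) then 1 else 0 :: real)"
      using elim(2) by (intro sum.cong) (auto simp: A_def)
    also have "\<dots> = card {g \<in> signed_perms n. 0 \<in> convex hull (S g \<omega> ` {1..n})}"
      using finite_signed_perms by (simp add: sum.If_cases Int_def)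
    also have "card {g \<in> signed_perms n. 0 \<in> convex hull (S g \<omega> ` {1..n})} = 2 * B_tail n (CARD('d) + 1)"
      using card_signed_perms_hull[of n "\<lambda>i. \<xi> i \<omega>"] elim(1) \<open>CARD('d) \<le> n\<close> unfolding S_def by simp
    finally show ?case .
  qed

  \<comment> \<open>All events \<open>A g\<close> have the same probability, so the sum of their
    probabilities is \<open>card (signed_perms n)\<close> copies of it; it is also the expectation
    of an almost surely constant count.\<close>
  have "(2 ^ n * fact n) * prob {\<omega> \<in> space M. 0 \<in> convex hull ((\<lambda>k. partial_sum \<xi> k \<omega>) ` {1..n})}
      = (\<Sum>g\<in>signed_perms n. prob (A g))"
    using prob_A card_signed_perms[of n] by simp
  also have "\<dots> = (\<Sum>g\<in>signed_perms n. expectation (indicator (A g)))"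
    using A by (intro sum.cong) auto
  also have "\<dots> = expectation (\<lambda>\<omega>. \<Sum>g\<in>signed_perms n. indicator (A g) \<omega>)"
    using A by (intro Bochner_Integration.integral_sum[symmetric]) (simp add: emeasure_finite less_top[symmetric])
  also have "\<dots> = expectation (\<lambda>\<omega>. real (2 * B_tail n (CARD('d) + 1)))"
    using A count by (intro integral_cong_AE borel_measurable_sum borel_measurable_indicator) auto
  also have "\<dots> = 2 * (\<Sum>j\<le>n. real (B_coeff n (CARD('d) + 1 + 2 * j)))"
    by (simp add: prob_space B_tail_def)
  finally show ?thesis by (simp add: field_simps)
qed

end
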